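(* Let $\kappa_1=\rho\|\mathcal A^\top\mathcal A\|$, $\kappa_2=\rho\|\mathcal B^\top\mathcal B\|$, $\kappa_3=\rho\|\mathcal A^\top\mathcal B\|$ (spectral norms), and assume that the parameters $\mu,\beta,\tau,\sigma$ satisfy $$0<\sigma<\tfrac1{24},\qquad \beta>\frac{4\kappa_1}{1-24\sigma}\Big(4+3\sigma+\sqrt{24-168\sigma+9\sigma^2}\Big)>0,\qquad \mu>\kappa_2+\frac{16\kappa_3^2}{\sigma\beta}>0,$$ $$\max\Big\{\frac\beta2,\ \frac{\beta}{24\sigma}\Big(1-\frac{16\kappa_1}{\beta}-\sqrt{\varsigma}\Big)\Big\}<\tau<\frac{\beta}{24\sigma}\Big(1-\frac{16\kappa_1}{\beta}+\sqrt{\varsigma}\Big),$$ where $\varsigma=1-\frac{32\kappa_1}{\beta}-\frac{128\kappa_1^2}{\beta^2}-\frac{24\kappa_1\sigma}{\beta}-24\sigma>0$. Then every sequence $\{(\widetilde W_k,\widetilde P_k,z_k,u_k)\}_{k\ge0}$ generated, from an initial point $(\widetilde W_0,\widetilde P_0,z_0,u_0)$, by the PALM iteration $$\begin{aligned} &\widetilde P_{k+1}\in\mathbf{prox}_{\mu^{-1}g}\big(\widetilde P_k-\mu^{-1}\nabla_{\widetilde P}H(\widetilde W_k,\widetilde P_k)\big),\\ &z_{k+1}\in\mathbf{prox}_{\beta^{-1}f}\big(\widetilde W_k+\beta^{-1}u_k\big),\\ &\widetilde W_{k+1}=\widetilde W_k-\tau^{-1}\big(\nabla_{\widetilde W}H(\widetilde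 W_k,\widetilde P_{k+1})+u_k+\beta(\widetilde W_k-z_{k+1})\big),\\ &u_{k+1}=u_k+\sigma\beta(\widetilde W_{k+1}-z_{k+1}) \end{aligned}$$ is bounded.
   Context: Data. Let $m,n,l,q,M\ge 1$ be integers and $p=m+n$; let $m=\sum_{i=1}^s m_i$, $n=\sum_{j=1}^t n_j$ be partitions into positive integers. Let $A\in\mathbb R^{n\times n}$, $B_2\in\mathbb R^{n\times m}$, $B_1\in\mathbb R^{n\times l}$, $C\in\mathbb R^{q\times n}$, $D\in\mathbb R^{q\times m}$. Put $Q=\begin{bmatrix}B_1B_1^\top&0\\0&0\end{bmatrix}$, $R=\begin{bmatrix}C^\top C&0\\0&D^\top D\end{bmatrix}$ in $\mathbb S^p$ (symmetric $p\times p$ matrices), $F_i=\begin{bmatrix}A_i&B_{2,i}\\0&0\end{bmatrix}\in\mathbb R^{p\times p}$ ($i=1,\dots,M$) given, with $A_i\in\mathbb R^{n\times n}$, $B_{2,i}\in\mathbb R^{n\times m}$. Put $V_1=[0,I_m]\in\mathbb R^{m\times p}$, $V_2=[I_n,0]\in\mathbb R^{n\times p}$ and $\Upsilon_i(W)=-V_2(F_iW+WF_i^\top+Q)V_2^\top$. Standing assumptions. (1) $C^\top D=0$, $D^\top D\succ0$, $C^\top C\succ0$, $B_1B_1^\top\succ0$, $(A,B_2)$ is stabilizable, and $(A,C)$ has no unobservable modes on the imaginary axis. (2) $\begin{bmatrix}A&B_2\\0&0\end{bmatrix}$ is a convex combination of $F_1,\dots,F_M$. (3) There is $W\in\mathbb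 S^p$ with $W\succ0$ and $\Upsilon_i(W)\succ0$ for all $i$. (4) Every $W\in\mathbb S^p$ with $W\succeq0$ and $\Upsilon_i(W)\succeq0$ for all $i$ has positive definite upper-left $n\times n$ block. Functions. $\mathrm{vec}$ stacks columns; $\Gamma_+^k=\{\mathrm{vec}(S):S\in\mathbb S^k,\ S\succeq0\}$; $\delta_E$ is the indicator function ($0$ on $E$, $+\infty$ off $E$). For $\widetilde W\in\mathbb R^{p^2}$, $\widetilde P\in\mathbb R^{mn}$, with $W=\mathrm{vec}^{-1}(\widetilde W)\in\mathbb R^{p\times p}$, $$f(\widetilde W)=\langle\mathrm{vec}(R),\widetilde W\rangle+\delta_{\Gamma_+^p}(\widetilde W)+\sum_{i=1}^M\delta_{\Gamma_+^n}(\mathrm{vec}(\Upsilon_i(W))),\qquad g(\widetilde P)=\gamma\,\|\mathrm{vec}^{-1}(\widetilde P)\|_{s,t;0},$$ where $\gamma>0$ and $\|P\|_{s,t;0}$ is the number of nonzero blocks $P_{ij}\in\mathbb R^{m_i\times n_j}$ of $P=(P_{ij})_{i\le s,j\le t}\in\mathbb R^{m\times n}$. Coupling. Let $N=t(t-1)/2$ and let $(\xi(j),\kappa(j))$, $j=1,\dots,N$, enumerate lexicographically the pairs $(a,b)$ with $1\le a<b\le t$. For $a\le t$ let $E_a=[0_{n_a\times\sum_{r<a}n_r},\ I_{n_a},\ 0]\in\mathbb R^{n_a\times p}$, and put $V_{j1}=E_{\xi(j)}$, $V_{j2}=E_{\kappa(j)}^\top$. Let $\mathcal A$ be the matrix obtained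 by stacking vertically $V_{12}^\top\otimes V_{11},\dots,V_{N2}^\top\otimes V_{N1}$, $V_2\otimes V_1$, and let $\mathcal B$ be obtained by stacking vertically zero blocks (matching the first $N$ blocks of $\mathcal A$) and $-I_{mn}$. For $\rho>0$ set $H(\widetilde W,\widetilde P)=\frac\rho2\|\mathcal A\widetilde W+\mathcal B\widetilde P\|^2$. The proximal operator is the (set-valued) map $\mathbf{prox}_{\alpha h}(z)=\operatorname{argmin}_y\{h(y)+\frac1{2\alpha}\|y-z\|^2\}$ for $\alpha>0$. *)

theory Defs
  imports
    "HOL-Library.Extended_Real"
    "HOL-Analysis.Derivative"
    "Jordan_Normal_Form.Matrix"
    "Jordan_Normal_Form.Char_Poly"
begin

text \<open>
  All matrices and vectors are those of Jordan_Normal_Form, whose dimensions are natural numbers.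
  Matrix entries are indexed from 0; the index sets of block partitions
  (\<open>i = 1..s\<close>, \<open>j = 1..t\<close>), of the vertices \<open>F\<^sub>i\<close> (\<open>i = 1..M\<close>) and of the pairs
  \<open>(\<xi>(j), \<kappa>(j))\<close> start at 1.
\<close>

unbundle no inner_syntax

subsection \<open>Vectors and matrices\<close>

definition vnorm :: "real vec \<Rightarrow> real" where
  "vnorm x = sqrt (x \<bullet> x)"

definition spectral_norm :: "real mat \<Rightarrow> real" where
  "spectral_norm M = Sup {vnorm (M *\<^sub>v x) | x. x \<in> carrier_vec (dim_col M) \<and> vnorm x \<le> 1}"

definition pos_semidef :: "nat \<Rightarrow> real mat \<Rightarrow> bool" where
  "pos_semidef k S \<longleftrightarrow> S \<in> carrier_mat k k \<and> transpose_mat S = S \<and>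
     (\<forall>x \<in> carrier_vec k. x \<bullet> (S *\<^sub>v x) \<ge> 0)"

definition pos_def :: "nat \<Rightarrow> real mat \<Rightarrow> bool" where
  "pos_def k S \<longleftrightarrow> S \<in> carrier_mat k k \<and> transpose_mat S = S \<and>
     (\<forall>x \<in> carrier_vec k. x \<noteq> 0\<^sub>v k \<longrightarrow> x \<bullet> (S *\<^sub>v x) > 0)"

text \<open>Column-stacking and its inverse on \<open>r \<times> c\<close> matrices.\<close>

definition vectorize :: "real mat \<Rightarrow> real vec" where
  "vectorize X = vec (dim_row X * dim_col X) (\<lambda>i. X $$ (i mod dim_row X, i div dim_row X))"

definition unvectorize :: "nat \<Rightarrow> nat \<Rightarrow> real vec \<Rightarrow> real mat" where
  "unvectorize r c v = mat r c (\<lambda>(i, j). v $ (j * r + i))"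

definition kron :: "real mat \<Rightarrow> real mat \<Rightarrow> real mat" where
  "kron X Y = mat (dim_row X * dim_row Y) (dim_col X * dim_col Y)
     (\<lambda>(i, j). X $$ (i div dim_row Y, j div dim_col Y) * Y $$ (i mod dim_row Y, j mod dim_col Y))"

definition append_cols :: "real mat \<Rightarrow> real mat \<Rightarrow> real mat" where
  "append_cols X Y = four_block_mat X Y (0\<^sub>m 0 (dim_col X)) (0\<^sub>m 0 (dim_col Y))"

definition upper_left :: "nat \<Rightarrow> real mat \<Rightarrow> real mat" where
  "upper_left k W = mat k k (\<lambda>(i, j). W $$ (i, j))"

subsection \<open>Linear systems\<close>

definition stabilizable :: "real mat \<Rightarrow> real mat \<Rightarrow> bool" where
  "stabilizable A B \<longleftrightarrow> (\<exists>K \<in> carrier_mat (dim_col B) (dim_row A).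
     \<forall>z. eigenvalue (map_mat complex_of_real (A + B * K)) z \<longrightarrow> Re z < 0)"

definition unobservable_mode :: "real mat \<Rightarrow> real mat \<Rightarrow> complex \<Rightarrow> bool" where
  "unobservable_mode A C z \<longleftrightarrow> (\<exists>x. eigenvector (map_mat complex_of_real A) x z \<and>
     map_mat complex_of_real C *\<^sub>v x = 0\<^sub>v (dim_row C))"

definition Upsilon :: "real mat \<Rightarrow> real mat \<Rightarrow> real mat \<Rightarrow> real mat \<Rightarrow> real mat" where
  "Upsilon V2 Q Fi W = - (V2 * (Fi * W + W * transpose_mat Fi + Q) * transpose_mat V2)"

subsection \<open>Proximal maps and gradients\<close>

definition indicator_fun :: "'a set \<Rightarrow> 'a \<Rightarrow> ereal" where
  "indicator_fun E x = (if x \<in> E then 0 else \<infinity>)"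

definition psd_cone_vec :: "nat \<Rightarrow> real vec set" where
  "psd_cone_vec k = {vectorize S | S. pos_semidef k S}"

text \<open>Here \<open>h\<close> is an extended-real function on \<open>\<real>\<^sup>d\<close>.\<close>

definition prox :: "nat \<Rightarrow> real \<Rightarrow> (real vec \<Rightarrow> ereal) \<Rightarrow> real vec \<Rightarrow> real vec set" where
  "prox d \<alpha> h z =
     {y. is_arg_min (\<lambda>y. h y + ereal (1 / (2 * \<alpha>) * (vnorm (y - z))\<^sup>2)) (\<lambda>y. y \<in> carrier_vec d) y}"

text \<open>The vector of partial derivatives of \<open>h\<close>, a function on \<open>\<real>\<^sup>d\<close>.\<close>

definition gradient :: "nat \<Rightarrow> (real vec \<Rightarrow> real) \<Rightarrow> real vec \<Rightarrow> real vec" where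
  "gradient d h x = vec d (\<lambda>i. deriv (\<lambda>r. h (x + r \<cdot>\<^sub>v unit_vec d i)) 0)"

subsection \<open>Block structure\<close>

definition offset :: "(nat \<Rightarrow> nat) \<Rightarrow> nat \<Rightarrow> nat" where
  "offset ks a = (\<Sum>r = 1..<a. ks r)"

definition block :: "(nat \<Rightarrow> nat) \<Rightarrow> (nat \<Rightarrow> nat) \<Rightarrow> real mat \<Rightarrow> nat \<Rightarrow> nat \<Rightarrow> real mat" where
  "block ms ns P i j = mat (ms i) (ns j) (\<lambda>(a, b). P $$ (offset ms i + a, offset ns j + b))"

definition block_l0 ::
  "nat \<Rightarrow> nat \<Rightarrow> (nat \<Rightarrow> nat) \<Rightarrow> (nat \<Rightarrow> nat) \<Rightarrow> real mat \<Rightarrow> nat" where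
  "block_l0 s t ms ns P =
     card {(i, j). i \<in> {1..s} \<and> j \<in> {1..t} \<and> block ms ns P i j \<noteq> 0\<^sub>m (ms i) (ns j)}"

text \<open>The pairs \<open>(a, b)\<close> with \<open>1 \<le> a < b \<le> t\<close> in lexicographic order.\<close>

definition pair_list :: "nat \<Rightarrow> (nat \<times> nat) list" where
  "pair_list t = concat (map (\<lambda>a. map (\<lambda>b. (a, b)) [Suc a..<Suc t]) [1..<Suc t])"

lemma set_pair_list: "set (pair_list t) = {(a, b). 1 \<le> a \<and> a < b \<and> b \<le> t}"
  by (auto simp: pair_list_def image_iff)

lemma length_pair_list: "length (pair_list t) = t * (t - 1) div 2"
proof -
  have "length (pair_list t) = (\<Sum>a = 1..<Suc t. t - a)"
    by (simp add: pair_list_def length_concat o_def sum_list_distinct_conv_sum_set del: upt_Suc)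
  also have "\<dots> = (\<Sum>i<t. i)"
    by (rule sum.reindex_bij_witness[of _ "\<lambda>i. t - i" "\<lambda>a. t - a"]) auto
  also have "\<dots> = t * (t - 1) div 2"
    by (cases t) (simp_all add: lessThan_Suc_atMost gauss_sum_nat atMost_atLeast0 mult.commute)
  finally show ?thesis .
qed

definition xi :: "nat \<Rightarrow> nat \<Rightarrow> nat" where
  "xi t j = fst (pair_list t ! (j - 1))"

definition kappa :: "nat \<Rightarrow> nat \<Rightarrow> nat" where
  "kappa t j = snd (pair_list t ! (j - 1))"

definition block_selector :: "nat \<Rightarrow> (nat \<Rightarrow> nat) \<Rightarrow> nat \<Rightarrow> real mat" where
  "block_selector p ns a =
     append_cols (0\<^sub>m (ns a) (offset ns a))
       (append_cols (1\<^sub>m (ns a)) (0\<^sub>m (ns a) (p - offset ns a - ns a)))"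

end

theory Submission
  imports Defs
begin

text \<open>
  The boundedness rests on a merit function that decreases along the iteration. Let \<open>L\<close> be the
  augmented Lagrangian \<open>f(z) + g(P) + H(W, P) + \<langle>u, W - z\<rangle> + \<beta>/2 \<parallel>W - z\<parallel>\<^sup>2\<close>. The two proximal steps
  and the gradient step do not increase \<open>L\<close>, while the dual step increases it by \<open>1/(\<sigma>\<beta>)\<close> times the
  squared increment of \<open>u\<close>. The gradient step relates that increment to the residual
  \<open>-\<sigma> (\<nabla>H + u)\<close>, which contracts with factor \<open>1 - \<sigma>\<close> up to terms in the increments of \<open>W\<close> and \<open>P\<close>
  (\<open>resid_contraction\<close>). Adding multiples of the squared increment of \<open>W\<close> and of the squared residual
  to \<open>L\<close> therefore gives a quantity that decreases by a positive multiple of the squared increments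
  of \<open>W\<close> and \<open>u\<close> (\<open>merit_descent\<close>); the interval between the two roots that confines \<open>\<tau>\<close> makes the
  coefficient left for the increment of \<open>W\<close> positive (\<open>step_size_condition\<close>), and \<open>\<mu>\<close> is large enough to absorb
  the increment of \<open>P\<close>.

  Since \<open>W - z\<close> is a multiple of the increment of \<open>u\<close>, the bilinear term of \<open>L\<close> telescopes, and a
  negative merit would make \<open>\<parallel>u\<parallel>\<^sup>2\<close> negative eventually (\<open>merit_nonneg\<close>). Hence the merit is bounded
  on both sides and the increments of \<open>W\<close> and \<open>u\<close> are bounded. Then \<open>\<parallel>u\<parallel>\<close> is at most a constant plus a multiple of
  \<open>sqrt H\<close>, while \<open>f + H\<close> is at most a constant plus a multiple of \<open>\<parallel>u\<parallel>\<close>; so \<open>H\<close>, \<open>u\<close> and \<open>f(z)\<close> are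
  bounded. On its domain \<open>f\<close> is the linear functional given by \<open>R\<close> on positive semidefinite
  matrices, which is coercive because \<open>C\<^sup>T C\<close> and \<open>D\<^sup>T D\<close> are positive definite
  (\<open>gram_coercive_on_psd_cone\<close>). This bounds \<open>z\<close>, hence \<open>W\<close>, and finally \<open>P\<close> because the matrix
  acting on \<open>P\<close> in the coupling is an isometry.

  The estimates are carried out in abstract real inner product spaces. Vectors of arbitrary
  dimension are embedded isometrically into the space of finitely supported sequences, on which
  matrices act as linear operators with the transposes as adjoints.
\<close>

section \<open>Elementary estimates\<close>

lemma norm_add_sq: "(norm (x + y))\<^sup>2 = (norm x)\<^sup>2 + 2 * inner x y + (norm y)\<^sup>2" for x y :: "'d::real_inner"
  by (simp add: power2_norm_eq_inner inner_simps inner_commute)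

lemma convex_norm_sq:
  fixes x y :: "'d::real_inner"
  assumes "0 \<le> s" "s \<le> 1"
  shows "(norm ((1 - s) *\<^sub>R x + s *\<^sub>R y))\<^sup>2 \<le> (1 - s) * (norm x)\<^sup>2 + s * (norm y)\<^sup>2"
proof -
  have "(1 - s) * (norm x)\<^sup>2 + s * (norm y)\<^sup>2 - (norm ((1 - s) *\<^sub>R x + s *\<^sub>R y))\<^sup>2
      = s * (1 - s) * (norm (x - y))\<^sup>2"
    unfolding power2_norm_eq_inner
    by (simp add: inner_simps inner_commute algebra_simps)
  then show ?thesis
    using assms by (smt (verit) mult_nonneg_nonneg zero_le_power2)
qed

lemma norm_add_sq_le: "(norm (x + y))\<^sup>2 \<le> 2 * (norm x)\<^sup>2 + 2 * (norm y)\<^sup>2" for x y :: "'d::real_inner"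
proof -
  have "2 * (norm x)\<^sup>2 + 2 * (norm y)\<^sup>2 - (norm (x + y))\<^sup>2 = (norm (x - y))\<^sup>2"
    unfolding power2_norm_eq_inner by (simp add: inner_simps inner_commute)
  then show ?thesis
    by (smt (verit) zero_le_power2)
qed

lemma norm_le_sqrt: "a > 0 \<Longrightarrow> a * x\<^sup>2 \<le> b \<Longrightarrow> x \<le> sqrt (b / a)" for a b x :: real
  by (rule real_le_rsqrt) (simp add: field_simps)

lemma quadratic_bound:
  fixes a b c x :: real
  assumes "a > 0" "b \<ge> 0" "x \<ge> 0" "a * x\<^sup>2 \<le> b + c * x"
  shows "x \<le> max 1 ((b + c) / a)"
proof (cases "x \<le> 1")
  case False
  then have "b \<le> b * x"
    using assms by (simp add: mult_le_cancel_left1)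
  then have "(a * x) * x \<le> (b + c) * x"
    using assms(4) by (simp add: power2_eq_square algebra_simps)
  then have "a * x \<le> b + c"
    using False by simp
  then show ?thesis
    using assms(1) by (simp add: field_simps le_max_iff_disj)
qed simp

lemma norm_sq_le_of_normal_bound:
  fixes T :: "'a::real_inner \<Rightarrow> 'b::real_inner" and T' :: "'b \<Rightarrow> 'a"
  assumes adj: "\<And>x y. inner (T x) y = inner x (T' y)"
    and bound: "\<And>x. \<rho> * norm (T' (T x)) \<le> \<kappa> * norm x" and "\<rho> > 0"
  shows "\<rho> * (norm (T x))\<^sup>2 \<le> \<kappa> * (norm x)\<^sup>2"
proof -
  have "\<rho> * (norm (T x))\<^sup>2 = \<rho> * inner x (T' (T x))"
    by (simp add: power2_norm_eq_inner adj)
  also have "\<dots> \<le> \<rho> * (norm x * norm (T' (T x)))"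
    using \<open>\<rho> > 0\<close> norm_cauchy_schwarz[of x "T' (T x)"] by simp
  also have "\<dots> = norm x * (\<rho> * norm (T' (T x)))" by simp
  also have "\<dots> \<le> norm x * (\<kappa> * norm x)"
    by (rule mult_left_mono[OF bound]) simp
  also have "\<dots> = \<kappa> * (norm x)\<^sup>2"
    by (simp add: power2_eq_square)
  finally show ?thesis .
qed

text \<open>
  The interval for \<open>\<tau>\<close> is the one between the two roots of a quadratic: multiplied by
  \<open>48 * \<sigma> / \<beta>\<close>, the claimed inequality says \<open>(x - c)\<^sup>2 < v\<close> for \<open>x = 24 * \<sigma> * \<tau> / \<beta>\<close> and
  \<open>c = 1 - 16 * \<kappa> / \<beta>\<close>.
\<close>

lemma step_size_condition:
  fixes \<sigma> \<beta> \<tau> \<kappa> v :: real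
  assumes "0 < \<sigma>" "0 < \<beta>"
    and v: "v = 1 - 32 * \<kappa> / \<beta> - 128 * \<kappa>\<^sup>2 / \<beta>\<^sup>2 - 24 * \<kappa> * \<sigma> / \<beta> - 24 * \<sigma>" "v > 0"
    and lower: "\<beta> / (24 * \<sigma>) * (1 - 16 * \<kappa> / \<beta> - sqrt v) < \<tau>"
    and upper: "\<tau> < \<beta> / (24 * \<sigma>) * (1 - 16 * \<kappa> / \<beta> + sqrt v)"
  shows "12 * \<sigma> * \<tau>\<^sup>2 / \<beta> + 16 * \<kappa> * \<tau> / \<beta> + 8 * \<kappa>\<^sup>2 / (\<sigma> * \<beta>) < \<tau> - (\<kappa> + \<beta>) / 2"
proof -
  define x where "x = 24 * \<sigma> * \<tau> / \<beta>"
  define c where "c = 1 - 16 * \<kappa> / \<beta>"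
  have \<tau>: "\<tau> = \<beta> / (24 * \<sigma>) * x"
    using assms(1,2) by (simp add: x_def)
  have pos: "\<beta> / (24 * \<sigma>) > 0"
    using assms(1,2) by simp
  have "c - sqrt v < x" "x < c + sqrt v"
    using lower upper mult_less_cancel_left_pos[OF pos] unfolding c_def[symmetric] \<tau> by blast+
  then have "\<bar>x - c\<bar> < sqrt v"
    by linarith
  then have "(x - c)\<^sup>2 < v"
    using real_sqrt_less_iff[of "(x - c)\<^sup>2" v] by simp
  moreover have "(x - c)\<^sup>2 - v
      = 48 * \<sigma> / \<beta> * (12 * \<sigma> * \<tau>\<^sup>2 / \<beta> + 16 * \<kappa> * \<tau> / \<beta> + 8 * \<kappa>\<^sup>2 / (\<sigma> * \<beta>) - (\<tau> - (\<kappa> + \<beta>) / 2))"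
    using assms(1,2) unfolding x_def c_def v(1) by (simp add: divide_simps) (simp add: power2_eq_square algebra_simps)
  ultimately have "48 * \<sigma> / \<beta>
      * (12 * \<sigma> * \<tau>\<^sup>2 / \<beta> + 16 * \<kappa> * \<tau> / \<beta> + 8 * \<kappa>\<^sup>2 / (\<sigma> * \<beta>) - (\<tau> - (\<kappa> + \<beta>) / 2)) < 0"
    by simp
  then have "12 * \<sigma> * \<tau>\<^sup>2 / \<beta> + 16 * \<kappa> * \<tau> / \<beta> + 8 * \<kappa>\<^sup>2 / (\<sigma> * \<beta>) - (\<tau> - (\<kappa> + \<beta>) / 2) < 0"
    using assms(1,2) by (metis divide_pos_pos mult_pos_pos zero_less_numeral mult_less_0_iff not_less_iff_gr_or_eq)
  then show ?thesis
    by simp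
qed

section \<open>Boundedness of the iteration in inner product spaces\<close>

text \<open>
  The iteration in abstract inner product spaces: \<open>At\<close> and \<open>Bt\<close> are the adjoints of the linear
  maps \<open>A\<close> and \<open>B\<close>, and the coupling term is \<open>\<rho> / 2 * (norm (A w + B v))\<^sup>2\<close>. The functions \<open>f\<close>
  and \<open>g\<close> are real valued and enter only through their values along the iterates, so \<open>f\<close> may be
  the finite part of an extended-real function. Of the two proximal steps only one comparison is
  kept: the new iterate is at least as good as the previous one. For \<open>z\<close> this comparison starts
  with \<open>z 1\<close>, because \<open>z 0\<close> is arbitrary and need not lie in the domain of \<open>f\<close>. The bound
  \<open>P_bound\<close> is likewise asked of the iterates only, so that \<open>B\<close> may have a kernel elsewhere.
\<close>

locale linearized_admm =
  fixes A :: "'a::real_inner \<Rightarrow> 'c::real_inner" and At :: "'c \<Rightarrow> 'a"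
    and B :: "'b::real_inner \<Rightarrow> 'c" and Bt :: "'c \<Rightarrow> 'b"
    and f :: "'a \<Rightarrow> real" and g :: "'b \<Rightarrow> real"
    and \<rho> \<mu> \<beta> \<tau> \<sigma> \<kappa>1 \<kappa>2 \<kappa>3 cf cB :: real
    and W z u :: "nat \<Rightarrow> 'a" and P :: "nat \<Rightarrow> 'b"
  assumes linA: "linear A" and linAt: "linear At" and linB: "linear B"
    and adjA: "\<And>x y. inner (A x) y = inner x (At y)"
    and adjB: "\<And>x y. inner (B x) y = inner x (Bt y)"
    and bound_AtA: "\<And>x. \<rho> * norm (At (A x)) \<le> \<kappa>1 * norm x"
    and bound_BtB: "\<And>y. \<rho> * norm (Bt (B y)) \<le> \<kappa>2 * norm y"
    and bound_AtB: "\<And>y. \<rho> * norm (At (B y)) \<le> \<kappa>3 * norm y"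
    and P_bound: "\<And>k. norm (P k) \<le> cB * norm (B (P k))"
    and rho_pos: "\<rho> > 0" and beta_pos: "\<beta> > 0"
    and sigma_pos: "0 < \<sigma>" and sigma_less: "\<sigma> < 1"
    and kappa1_nonneg: "\<kappa>1 \<ge> 0" and const_nonneg: "cf \<ge> 0" "cB \<ge> 0"
    and tau_large: "\<beta> / 2 < \<tau>"
    and tau_rate: "12 * \<sigma> * \<tau>\<^sup>2 / \<beta> + 16 * \<kappa>1 * \<tau> / \<beta> + 8 * \<kappa>1\<^sup>2 / (\<sigma> * \<beta>) < \<tau> - (\<kappa>1 + \<beta>) / 2"
    and mu_pos: "\<mu> > 0"
    and mu_large: "\<mu> > \<kappa>2 + 16 * \<kappa>3\<^sup>2 / (\<sigma> * \<beta>)"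
    and g_nonneg: "\<And>k. g (P k) \<ge> 0"
    and f_coercive: "\<And>k. norm (z (Suc k)) \<le> cf * f (z (Suc k))"
    and f_nonneg: "\<And>k. f (z (Suc k)) \<ge> 0"
    and step_P: "\<And>k. g (P (Suc k))
        + \<mu> / 2 * (norm (P (Suc k) - (P k - (1 / \<mu>) *\<^sub>R (\<rho> *\<^sub>R Bt (A (W k) + B (P k))))))\<^sup>2
        \<le> g (P k) + \<mu> / 2 * (norm (P k - (P k - (1 / \<mu>) *\<^sub>R (\<rho> *\<^sub>R Bt (A (W k) + B (P k))))))\<^sup>2"
    and step_z: "\<And>k. f (z (Suc (Suc k)))
        + \<beta> / 2 * (norm (z (Suc (Suc k)) - (W (Suc k) + (1 / \<beta>) *\<^sub>R u (Suc k))))\<^sup>2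
        \<le> f (z (Suc k)) + \<beta> / 2 * (norm (z (Suc k) - (W (Suc k) + (1 / \<beta>) *\<^sub>R u (Suc k))))\<^sup>2"
    and step_W: "\<And>k. W (Suc k) = W k - (1 / \<tau>) *\<^sub>R
        (\<rho> *\<^sub>R At (A (W k) + B (P (Suc k))) + u k + \<beta> *\<^sub>R (W k - z (Suc k)))"
    and step_u: "\<And>k. u (Suc k) = u k + (\<sigma> * \<beta>) *\<^sub>R (W (Suc k) - z (Suc k))"
begin

definition coupling :: "'a \<Rightarrow> 'b \<Rightarrow> real" where
  "coupling w v = \<rho> / 2 * (norm (A w + B v))\<^sup>2"

definition coupling_grad :: "'a \<Rightarrow> 'b \<Rightarrow> 'a" where
  "coupling_grad w v = \<rho> *\<^sub>R At (A w + B v)"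

text \<open>The increments are indexed by the old iterate.\<close>

definition dW where "dW k = W (Suc k) - W k"
definition dP where "dP k = P (Suc k) - P k"
definition du where "du k = u (Suc k) - u k"

text \<open>
  The scaled violation of the stationarity condition that the multiplier equals minus the gradient
  of the coupling; it vanishes at a fixed point of the iteration.
\<close>

definition resid where "resid k = - \<sigma> *\<^sub>R (coupling_grad (W k) (P (Suc k)) + u k)"

text \<open>The augmented Lagrangian of the splitting \<open>W = z\<close> at the \<open>k\<close>-th iterate.\<close>

definition lagrangian :: "nat \<Rightarrow> real" where
  "lagrangian k = f (z k) + g (P k) + coupling (W k) (P k)
     + inner (u k) (W k - z k) + \<beta> / 2 * (norm (W k - z k))\<^sup>2"

lemma tau_pos: "\<tau> > 0"
  using tau_large beta_pos by simp

lemmas bound_A = norm_sq_le_of_normal_bound[OF adjA bound_AtA rho_pos]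

lemmas bound_B = norm_sq_le_of_normal_bound[OF adjB bound_BtB rho_pos]

lemma coupling_descent_W:
  "coupling (w + d) v \<le> coupling w v + inner (coupling_grad w v) d + \<kappa>1 / 2 * (norm d)\<^sup>2"
proof -
  have eq: "A (w + d) + B v = (A w + B v) + A d"
    by (simp add: linear_add[OF linA])
  have 1: "inner (A w + B v) (A d) = inner (At (A w + B v)) d"
    by (metis adjA inner_commute)
  show ?thesis
    unfolding coupling_def coupling_grad_def eq norm_add_sq 1
    using bound_A[of d] by (simp add: algebra_simps)
qed

lemma coupling_descent_P:
  "coupling w (v + d) \<le> coupling w v + inner (\<rho> *\<^sub>R Bt (A w + B v)) d + \<kappa>2 / 2 * (norm d)\<^sup>2"
proof -
  have eq: "A w + B (v + d) = (A w + B v) + B d"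
    by (simp add: linear_add[OF linB])
  have 1: "inner (A w + B v) (B d) = inner (Bt (A w + B v)) d"
    by (metis adjB inner_commute)
  show ?thesis
    unfolding coupling_def eq norm_add_sq 1
    using bound_B[of d] by (simp add: algebra_simps)
qed

lemma descent_P:
  "g (P (Suc k)) + coupling (W k) (P (Suc k))
     \<le> g (P k) + coupling (W k) (P k) - (\<mu> - \<kappa>2) / 2 * (norm (dP k))\<^sup>2"
proof -
  define G where "G = \<rho> *\<^sub>R Bt (A (W k) + B (P k))"
  have P: "P (Suc k) = P k + dP k"
    by (simp add: dP_def)
  have e: "P (Suc k) - (P k - (1 / \<mu>) *\<^sub>R G) = dP k + (1 / \<mu>) *\<^sub>R G"
      "P k - (P k - (1 / \<mu>) *\<^sub>R G) = (1 / \<mu>) *\<^sub>R G"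
    by (simp_all add: dP_def)
  have "g (P (Suc k)) + \<mu> / 2 * (norm (dP k + (1 / \<mu>) *\<^sub>R G))\<^sup>2
      \<le> g (P k) + \<mu> / 2 * (norm ((1 / \<mu>) *\<^sub>R G))\<^sup>2"
    using step_P[of k] unfolding G_def[symmetric] e .
  then have "g (P (Suc k)) + \<mu> / 2 * (norm (dP k))\<^sup>2 + inner G (dP k) \<le> g (P k)"
    unfolding norm_add_sq using mu_pos by (simp add: algebra_simps inner_commute)
  moreover have "coupling (W k) (P (Suc k))
      \<le> coupling (W k) (P k) + inner G (dP k) + \<kappa>2 / 2 * (norm (dP k))\<^sup>2"
    unfolding P G_def by (rule coupling_descent_P)
  ultimately show ?thesis
    by (simp add: left_diff_distrib diff_divide_distrib)
qed

lemma descent_z: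
  "f (z (Suc (Suc k))) + inner (u (Suc k)) (W (Suc k) - z (Suc (Suc k)))
      + \<beta> / 2 * (norm (W (Suc k) - z (Suc (Suc k))))\<^sup>2
    \<le> f (z (Suc k)) + inner (u (Suc k)) (W (Suc k) - z (Suc k))
      + \<beta> / 2 * (norm (W (Suc k) - z (Suc k)))\<^sup>2"
proof -
  have eq: "\<beta> / 2 * (norm (y - (w + (1 / \<beta>) *\<^sub>R v)))\<^sup>2
      = \<beta> / 2 * (norm (w - y))\<^sup>2 + inner v (w - y) + \<beta> / 2 * (norm ((1 / \<beta>) *\<^sub>R v))\<^sup>2"
    for y w v :: 'a
  proof -
    have "norm (y - (w + (1 / \<beta>) *\<^sub>R v)) = norm ((w - y) + (1 / \<beta>) *\<^sub>R v)"
      by (metis add_diff_eq add.commute diff_diff_eq2 norm_minus_commute)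
    then have "\<beta> / 2 * (norm (y - (w + (1 / \<beta>) *\<^sub>R v)))\<^sup>2
        = \<beta> / 2 * ((norm (w - y))\<^sup>2 + 2 * inner (w - y) ((1 / \<beta>) *\<^sub>R v) + (norm ((1 / \<beta>) *\<^sub>R v))\<^sup>2)"
      by (simp only: norm_add_sq)
    also have "inner (w - y) ((1 / \<beta>) *\<^sub>R v) = 1 / \<beta> * inner v (w - y)"
      by (simp add: inner_commute)
    finally show ?thesis
      using beta_pos by (simp add: distrib_left)
  qed
  show ?thesis
    using step_z[of k] unfolding eq by simp
qed

lemma multiplier_identity:
  "coupling_grad (W k) (P (Suc k)) + u k + \<beta> *\<^sub>R (W k - z (Suc k)) = - \<tau> *\<^sub>R dW k"
  unfolding dW_def using step_W[of k] tau_pos by (simp add: coupling_grad_def)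

lemma primal_gap: "W (Suc k) - z (Suc k) = (1 / (\<sigma> * \<beta>)) *\<^sub>R du k"
  unfolding du_def step_u[of k] using sigma_pos beta_pos by simp

text \<open>
  The steps for \<open>P\<close>, \<open>z\<close> and \<open>W\<close> account for the two negative terms (the step for \<open>z\<close> is merely
  known not to increase the augmented Lagrangian), the ascent step for \<open>u\<close> for the positive one.
\<close>

lemma descent_lagrangian:
  "lagrangian (Suc (Suc k)) \<le> lagrangian (Suc k)
     - (\<tau> - (\<kappa>1 + \<beta>) / 2) * (norm (dW (Suc k)))\<^sup>2
     - (\<mu> - \<kappa>2) / 2 * (norm (dP (Suc k)))\<^sup>2 + 1 / (\<sigma> * \<beta>) * (norm (du (Suc k)))\<^sup>2"
proof -
  let ?w = "W (Suc k)" and ?w' = "W (Suc (Suc k))" and ?z' = "z (Suc (Suc k))"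
    and ?P' = "P (Suc (Suc k))" and ?d = "dW (Suc k)"
  have w': "?w' = ?w + ?d"
    by (simp add: dW_def)
  have gap: "?w' - ?z' = (?w - ?z') + ?d"
    by (simp add: dW_def)
  have 1: "coupling ?w' ?P' \<le> coupling ?w ?P' + inner (coupling_grad ?w ?P') ?d + \<kappa>1 / 2 * (norm ?d)\<^sup>2"
    unfolding w' by (rule coupling_descent_W)
  have "inner (coupling_grad ?w ?P' + u (Suc k) + \<beta> *\<^sub>R (?w - ?z')) ?d = - \<tau> * (norm ?d)\<^sup>2"
    unfolding multiplier_identity by (simp add: power2_norm_eq_inner)
  then have 2: "inner (coupling_grad ?w ?P') ?d + inner (u (Suc k)) ?d + \<beta> * inner (?w - ?z') ?d
      = - \<tau> * (norm ?d)\<^sup>2"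
    by (simp only: inner_add_left inner_scaleR_left)
  have 3: "(norm (?w' - ?z'))\<^sup>2 = (norm (?w - ?z'))\<^sup>2 + 2 * inner (?w - ?z') ?d + (norm ?d)\<^sup>2"
    unfolding gap norm_add_sq ..
  have "inner (u (Suc (Suc k))) (?w' - ?z') = inner (u (Suc k)) (?w' - ?z') + inner (du (Suc k)) (?w' - ?z')"
    by (simp add: du_def inner_diff_left)
  also have "inner (du (Suc k)) (?w' - ?z') = 1 / (\<sigma> * \<beta>) * (norm (du (Suc k)))\<^sup>2"
    unfolding primal_gap by (simp add: power2_norm_eq_inner)
  also have "inner (u (Suc k)) (?w' - ?z') = inner (u (Suc k)) (?w - ?z') + inner (u (Suc k)) ?d"
    unfolding gap by (rule inner_add_right)
  finally have 4: "inner (u (Suc (Suc k))) (?w' - ?z')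
      = inner (u (Suc k)) (?w - ?z') + inner (u (Suc k)) ?d + 1 / (\<sigma> * \<beta>) * (norm (du (Suc k)))\<^sup>2" .
  have 5: "\<beta> / 2 * (norm (?w' - ?z'))\<^sup>2
      = \<beta> / 2 * (norm (?w - ?z'))\<^sup>2 + \<beta> * inner (?w - ?z') ?d + \<beta> / 2 * (norm ?d)\<^sup>2"
    unfolding 3 by (simp add: distrib_left)
  have 6: "(\<tau> - (\<kappa>1 + \<beta>) / 2) * (norm ?d)\<^sup>2
      = \<tau> * (norm ?d)\<^sup>2 - \<kappa>1 / 2 * (norm ?d)\<^sup>2 - \<beta> / 2 * (norm ?d)\<^sup>2"
    by (simp add: field_simps)
  show ?thesis
    using 1 2 descent_P[of "Suc k"] descent_z[of k]
    unfolding lagrangian_def 4 5 6 by linarith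
qed

text \<open>
  By the step for \<open>W\<close>, the multiplier increment differs from the residual only by a multiple of the
  increment of \<open>W\<close>, so that a contraction of the residual controls the ascent step.
\<close>

lemma du_resid: "resid k = du k + (\<sigma> * (\<tau> - \<beta>)) *\<^sub>R dW k"
proof -
  have "\<beta> *\<^sub>R (W (Suc k) - z (Suc k)) = \<beta> *\<^sub>R (W k - z (Suc k)) + \<beta> *\<^sub>R dW k"
    by (simp add: dW_def algebra_simps)
  also have "\<dots> = - \<tau> *\<^sub>R dW k - (coupling_grad (W k) (P (Suc k)) + u k) + \<beta> *\<^sub>R dW k"
    using multiplier_identity[of k] by (simp add: algebra_simps)
  finally have eq: "\<beta> *\<^sub>R (W (Suc k) - z (Suc k))
      = (\<beta> - \<tau>) *\<^sub>R dW k - (coupling_grad (W k) (P (Suc k)) + u k)"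
    by (simp add: algebra_simps)
  have "du k = \<sigma> *\<^sub>R (\<beta> *\<^sub>R (W (Suc k) - z (Suc k)))"
    unfolding du_def step_u[of k] by simp
  then show ?thesis
    unfolding eq resid_def by (simp add: algebra_simps)
qed

lemma coupling_grad_diff:
  "coupling_grad w v - coupling_grad w' v' = \<rho> *\<^sub>R At (A (w - w')) + \<rho> *\<^sub>R At (B (v - v'))"
  unfolding coupling_grad_def
  by (simp add: linear_add[OF linAt] linear_diff[OF linAt] linear_diff[OF linA] linear_diff[OF linB]
      algebra_simps)

text \<open>
  The residual satisfies \<open>resid (k + 1) = (1 - \<sigma>) resid k + \<sigma> (x + y)\<close>, where \<open>x\<close> and \<open>y\<close> are
  controlled by the increments of \<open>W\<close> and \<open>P\<close>. As \<open>0 < \<sigma> < 1\<close> this is a convex combination. The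
  condition \<open>\<beta> / 2 < \<tau>\<close> serves to bound \<open>\<bar>\<tau> - \<beta>\<bar>\<close> by \<open>\<tau>\<close>.
\<close>

lemma resid_contraction:
  "(norm (resid (Suc k)))\<^sup>2 \<le> (1 - \<sigma>) * (norm (resid k))\<^sup>2
     + \<sigma> * (2 * (\<sigma> * \<tau> + \<kappa>1)\<^sup>2 * (norm (dW k))\<^sup>2 + 2 * \<kappa>3\<^sup>2 * (norm (dP (Suc k)))\<^sup>2)"
proof -
  define x where "x = (\<sigma> * (\<tau> - \<beta>)) *\<^sub>R dW k - \<rho> *\<^sub>R At (A (dW k))"
  define y where "y = - (\<rho> *\<^sub>R At (B (dP (Suc k))))"
  have G: "coupling_grad (W (Suc k)) (P (Suc (Suc k))) - coupling_grad (W k) (P (Suc k))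
      = \<rho> *\<^sub>R At (A (dW k)) + \<rho> *\<^sub>R At (B (dP (Suc k)))"
    unfolding dW_def dP_def by (rule coupling_grad_diff)
  have "resid (Suc k) = resid k
      - \<sigma> *\<^sub>R (coupling_grad (W (Suc k)) (P (Suc (Suc k))) - coupling_grad (W k) (P (Suc k))) - \<sigma> *\<^sub>R du k"
    unfolding resid_def du_def by (simp add: algebra_simps)
  also have "du k = resid k - (\<sigma> * (\<tau> - \<beta>)) *\<^sub>R dW k"
    using du_resid[of k] by simp
  finally have eq: "resid (Suc k) = (1 - \<sigma>) *\<^sub>R resid k + \<sigma> *\<^sub>R (x + y)"
    unfolding G x_def y_def by (simp add: algebra_simps)
  have "\<bar>\<tau> - \<beta>\<bar> \<le> \<tau>"
    using tau_large beta_pos by linarith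
  then have "norm ((\<sigma> * (\<tau> - \<beta>)) *\<^sub>R dW k) \<le> \<sigma> * \<tau> * norm (dW k)"
    using sigma_pos by (simp add: abs_mult mult_right_mono)
  moreover have "norm (\<rho> *\<^sub>R At (A (dW k))) \<le> \<kappa>1 * norm (dW k)"
    using bound_AtA[of "dW k"] rho_pos by simp
  ultimately have "norm x \<le> (\<sigma> * \<tau> + \<kappa>1) * norm (dW k)"
    unfolding x_def by (smt (verit) norm_triangle_ineq4 distrib_right)
  then have x: "(norm x)\<^sup>2 \<le> (\<sigma> * \<tau> + \<kappa>1)\<^sup>2 * (norm (dW k))\<^sup>2"
    by (metis power_mult_distrib norm_ge_zero power_mono)
  have "norm y \<le> \<kappa>3 * norm (dP (Suc k))"
    using bound_AtB[of "dP (Suc k)"] rho_pos by (simp add: y_def)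
  then have y: "(norm y)\<^sup>2 \<le> \<kappa>3\<^sup>2 * (norm (dP (Suc k)))\<^sup>2"
    by (metis power_mult_distrib norm_ge_zero power_mono)
  have "(norm (resid (Suc k)))\<^sup>2 \<le> (1 - \<sigma>) * (norm (resid k))\<^sup>2 + \<sigma> * (norm (x + y))\<^sup>2"
    unfolding eq using sigma_pos sigma_less by (intro convex_norm_sq) auto
  also have "\<sigma> * (norm (x + y))\<^sup>2
      \<le> \<sigma> * (2 * (\<sigma> * \<tau> + \<kappa>1)\<^sup>2 * (norm (dW k))\<^sup>2 + 2 * \<kappa>3\<^sup>2 * (norm (dP (Suc k)))\<^sup>2)"
    using norm_add_sq_le[of x y] x y sigma_pos by (intro mult_left_mono) auto
  finally show ?thesis by simp
qed

lemma du_bound: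
  "\<sigma> * (norm (du (Suc k)))\<^sup>2 \<le> 2 * (1 - \<sigma>) * ((norm (resid k))\<^sup>2 - (norm (resid (Suc k)))\<^sup>2)
     + \<sigma> * (2 * (\<sigma> * \<tau>)\<^sup>2 * (norm (dW (Suc k)))\<^sup>2 + 4 * (\<sigma> * \<tau> + \<kappa>1)\<^sup>2 * (norm (dW k))\<^sup>2
        + 4 * \<kappa>3\<^sup>2 * (norm (dP (Suc k)))\<^sup>2)"
proof -
  have "du (Suc k) = resid (Suc k) + (- (\<sigma> * (\<tau> - \<beta>))) *\<^sub>R dW (Suc k)"
    using du_resid[of "Suc k"] by simp
  then have "(norm (du (Suc k)))\<^sup>2 \<le> 2 * (norm (resid (Suc k)))\<^sup>2
      + 2 * (norm ((- (\<sigma> * (\<tau> - \<beta>))) *\<^sub>R dW (Suc k)))\<^sup>2"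
    by (simp only: norm_add_sq_le)
  also have "(norm ((- (\<sigma> * (\<tau> - \<beta>))) *\<^sub>R dW (Suc k)))\<^sup>2 = (\<sigma> * (\<tau> - \<beta>))\<^sup>2 * (norm (dW (Suc k)))\<^sup>2"
    by (simp add: power_mult_distrib)
  also have "\<dots> \<le> (\<sigma> * \<tau>)\<^sup>2 * (norm (dW (Suc k)))\<^sup>2"
  proof (rule mult_right_mono)
    have "\<bar>\<sigma> * (\<tau> - \<beta>)\<bar> \<le> \<bar>\<sigma> * \<tau>\<bar>"
      unfolding abs_mult using tau_large beta_pos sigma_pos by (intro mult_left_mono) auto
    then show "(\<sigma> * (\<tau> - \<beta>))\<^sup>2 \<le> (\<sigma> * \<tau>)\<^sup>2"
      by (simp only: abs_le_square_iff)
  qed simp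
  finally have "(norm (du (Suc k)))\<^sup>2
      \<le> 2 * (norm (resid (Suc k)))\<^sup>2 + 2 * ((\<sigma> * \<tau>)\<^sup>2 * (norm (dW (Suc k)))\<^sup>2)"
    by simp
  then have "\<sigma> * (norm (du (Suc k)))\<^sup>2
      \<le> \<sigma> * (2 * (norm (resid (Suc k)))\<^sup>2 + 2 * ((\<sigma> * \<tau>)\<^sup>2 * (norm (dW (Suc k)))\<^sup>2))"
    using sigma_pos by simp
  then show ?thesis
    using resid_contraction[of k] by (simp add: algebra_simps)
qed

text \<open>
  The merit function is the augmented Lagrangian plus multiples of the squared last increment of
  \<open>W\<close> and of the squared last residual. The weights are those produced by twice the estimate of
  \<open>(norm (du k))\<^sup>2\<close> in \<open>du_bound\<close>: one copy absorbs the ascent step, the other one leaves a decrease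
  proportional to \<open>(norm (du k))\<^sup>2\<close>. The number \<open>rateW\<close> is what then remains of the decrease in \<open>W\<close>.
  The merit at \<open>k\<close> belongs to the iterate \<open>k + 1\<close>.
\<close>

definition weightW :: real where "weightW = 8 * (\<sigma> * \<tau> + \<kappa>1)\<^sup>2 / (\<sigma> * \<beta>)"
definition weight_resid :: real where "weight_resid = 4 * (1 - \<sigma>) / (\<sigma>\<^sup>2 * \<beta>)"
definition rateW :: real where
  "rateW = \<tau> - (\<kappa>1 + \<beta>) / 2 - 4 * (\<sigma> * \<tau>)\<^sup>2 / (\<sigma> * \<beta>) - weightW"

definition merit :: "nat \<Rightarrow> real" where
  "merit k = lagrangian (Suc k) + weightW * (norm (dW k))\<^sup>2 + weight_resid * (norm (resid k))\<^sup>2"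

lemma weights_nonneg: "weightW \<ge> 0" "weight_resid \<ge> 0"
  using sigma_pos sigma_less beta_pos unfolding weightW_def weight_resid_def by auto

lemma rateW_pos: "rateW > 0"
proof -
  have "4 * (\<sigma> * \<tau>)\<^sup>2 / (\<sigma> * \<beta>) + weightW
      = 12 * \<sigma> * \<tau>\<^sup>2 / \<beta> + 16 * \<kappa>1 * \<tau> / \<beta> + 8 * \<kappa>1\<^sup>2 / (\<sigma> * \<beta>)"
    using sigma_pos beta_pos unfolding weightW_def by (simp add: field_simps power2_eq_square)
  then show ?thesis
    using tau_rate unfolding rateW_def by linarith
qed

lemma merit_descent:
  "merit (Suc k) + rateW * (norm (dW (Suc k)))\<^sup>2 + 1 / (\<sigma> * \<beta>) * (norm (du (Suc k)))\<^sup>2 \<le> merit k"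
proof -
  define a b d e e' where defs: "a = (norm (dW k))\<^sup>2" "b = (norm (dW (Suc k)))\<^sup>2"
    "d = (norm (dP (Suc k)))\<^sup>2" "e = (norm (resid k))\<^sup>2" "e' = (norm (resid (Suc k)))\<^sup>2"
  have d0: "d \<ge> 0"
    by (simp add: defs)
  have "(norm (du (Suc k)))\<^sup>2 * 2 / (\<sigma> * \<beta>) = 2 / (\<sigma>\<^sup>2 * \<beta>) * (\<sigma> * (norm (du (Suc k)))\<^sup>2)"
    using sigma_pos beta_pos by (simp add: field_simps power2_eq_square)
  also have "\<dots> \<le> 2 / (\<sigma>\<^sup>2 * \<beta>) * (2 * (1 - \<sigma>) * (e - e') + \<sigma> * (2 * (\<sigma> * \<tau>)\<^sup>2 * b
      + 4 * (\<sigma> * \<tau> + \<kappa>1)\<^sup>2 * a + 4 * \<kappa>3\<^sup>2 * d))"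
    using du_bound[of k] beta_pos unfolding defs by (intro mult_left_mono) auto
  also have "\<dots> = weight_resid * (e - e') + 4 * (\<sigma> * \<tau>)\<^sup>2 / (\<sigma> * \<beta>) * b + weightW * a
      + 8 * \<kappa>3\<^sup>2 / (\<sigma> * \<beta>) * d"
    using sigma_pos beta_pos unfolding weightW_def weight_resid_def
    by (simp add: divide_simps) (simp add: power2_eq_square algebra_simps)
  finally have 1: "2 * (1 / (\<sigma> * \<beta>) * (norm (du (Suc k)))\<^sup>2)
      \<le> weight_resid * (e - e') + 4 * (\<sigma> * \<tau>)\<^sup>2 / (\<sigma> * \<beta>) * b + weightW * a
      + 8 * \<kappa>3\<^sup>2 / (\<sigma> * \<beta>) * d" by (simp add: mult.commute)
  have 2: "8 * \<kappa>3\<^sup>2 / (\<sigma> * \<beta>) * d \<le> (\<mu> - \<kappa>2) / 2 * d"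
    using mu_large d0 by (intro mult_right_mono) auto
  have 3: "rateW * b = (\<tau> - (\<kappa>1 + \<beta>) / 2) * b - 4 * (\<sigma> * \<tau>)\<^sup>2 / (\<sigma> * \<beta>) * b - weightW * b"
    unfolding rateW_def by (simp only: left_diff_distrib)
  have sum_up: "L' + wb + E' + r + q \<le> L + wa + E"
    if "2 * q \<le> D + T + wa + d'" "d' \<le> Y" "r = X - T - wb" "D = E - E'" "L' \<le> L - X - Y + q"
    for L L' X Y E E' D T wa wb r q d' :: real
    using that by linarith
  show ?thesis
    unfolding merit_def defs[symmetric]
    by (rule sum_up[OF 1 2 3 right_diff_distrib descent_lagrangian[of k, folded defs]])
qed

lemma merit_antimono: "i \<le> j \<Longrightarrow> merit j \<le> merit i"
proof (induction j rule: dec_induct)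
  case (step n)
  have "rateW * (norm (dW (Suc n)))\<^sup>2 \<ge> 0" "1 / (\<sigma> * \<beta>) * (norm (du (Suc n)))\<^sup>2 \<ge> 0"
    using rateW_pos sigma_pos beta_pos by auto
  with merit_descent[of n] step show ?case by linarith
qed simp

text \<open>
  Since \<open>W - z\<close> is a multiple of the last multiplier increment, the bilinear term telescopes up
  to a nonnegative remainder.
\<close>

lemma lagrangian_lower:
  "lagrangian (Suc k) \<ge> ((norm (u (Suc k)))\<^sup>2 - (norm (u k))\<^sup>2) / (2 * \<sigma> * \<beta>)"
proof -
  have "inner (u (Suc k)) (du k) * 2 = (norm (u (Suc k)))\<^sup>2 - (norm (u k))\<^sup>2 + (norm (du k))\<^sup>2"
    unfolding power2_norm_eq_inner du_def by (simp add: inner_simps inner_commute)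
  then have "inner (u (Suc k)) (du k) \<ge> ((norm (u (Suc k)))\<^sup>2 - (norm (u k))\<^sup>2) / 2"
    by (simp add: field_simps)
  then have "inner (u (Suc k)) (W (Suc k) - z (Suc k))
      \<ge> 1 / (\<sigma> * \<beta>) * (((norm (u (Suc k)))\<^sup>2 - (norm (u k))\<^sup>2) / 2)"
    unfolding primal_gap inner_scaleR_right
    using sigma_pos beta_pos by (intro mult_left_mono) auto
  moreover have "1 / (\<sigma> * \<beta>) * (((norm (u (Suc k)))\<^sup>2 - (norm (u k))\<^sup>2) / 2)
      = ((norm (u (Suc k)))\<^sup>2 - (norm (u k))\<^sup>2) / (2 * \<sigma> * \<beta>)"
    by simp
  moreover have "coupling (W (Suc k)) (P (Suc k)) \<ge> 0"
    using rho_pos by (simp add: coupling_def)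
  moreover have "\<beta> / 2 * (norm (W (Suc k) - z (Suc k)))\<^sup>2 \<ge> 0"
    using beta_pos by simp
  ultimately show ?thesis
    unfolding lagrangian_def using f_nonneg[of k] g_nonneg[of "Suc k"] by simp
qed

text \<open>
  If the merit were negative once, it would stay below that negative value, and the telescoping
  lower bound would push \<open>(norm (u k))\<^sup>2\<close> below zero.
\<close>

lemma merit_nonneg: "merit j \<ge> 0"
proof (rule ccontr)
  assume neg: "\<not> merit j \<ge> 0"
  define c where "c = - (2 * \<sigma> * \<beta> * merit j)"
  have c: "c > 0"
    using neg sigma_pos beta_pos unfolding c_def by (simp add: mult_pos_neg)
  have step: "(norm (u (Suc k)))\<^sup>2 \<le> (norm (u k))\<^sup>2 - c" if "j \<le> k" for k
  proof -
    have "((norm (u (Suc k)))\<^sup>2 - (norm (u k))\<^sup>2) / (2 * \<sigma> * \<beta>) \<le> lagrangian (Suc k)"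
      by (rule lagrangian_lower)
    also have "\<dots> \<le> merit k"
      unfolding merit_def using weights_nonneg by simp
    also have "\<dots> \<le> merit j"
      by (rule merit_antimono[OF that])
    finally show ?thesis
      using sigma_pos beta_pos unfolding c_def by (simp add: field_simps)
  qed
  have "(norm (u (j + i)))\<^sup>2 \<le> (norm (u j))\<^sup>2 - real i * c" for i
  proof (induction i)
    case (Suc i)
    then show ?case using step[of "j + i"] by (simp add: algebra_simps)
  qed simp
  moreover obtain i where "real i * c > (norm (u j))\<^sup>2"
    using c reals_Archimedean3 by blast
  ultimately show False
    by (smt (verit) zero_le_power2)
qed

lemma increments_bounded:
  "norm (dW (Suc k)) \<le> sqrt (merit 0 / rateW)"
  "norm (du (Suc k)) \<le> sqrt (merit 0 / (1 / (\<sigma> * \<beta>)))"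
proof -
  have "rateW * (norm (dW (Suc k)))\<^sup>2 \<ge> 0" "1 / (\<sigma> * \<beta>) * (norm (du (Suc k)))\<^sup>2 \<ge> 0"
    using rateW_pos sigma_pos beta_pos by auto
  moreover have "merit k \<le> merit 0"
    by (rule merit_antimono) simp
  ultimately have "rateW * (norm (dW (Suc k)))\<^sup>2 \<le> merit 0"
      "1 / (\<sigma> * \<beta>) * (norm (du (Suc k)))\<^sup>2 \<le> merit 0"
    using merit_descent[of k] merit_nonneg[of "Suc k"] by linarith+
  then show "norm (dW (Suc k)) \<le> sqrt (merit 0 / rateW)"
      "norm (du (Suc k)) \<le> sqrt (merit 0 / (1 / (\<sigma> * \<beta>)))"
    using rateW_pos sigma_pos beta_pos by (auto intro!: norm_le_sqrt simp del: times_divide_eq_right divide_divide_eq_right)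
qed

text \<open>The two bounds by \<open>sqrt (\<kappa>1 / \<rho>)\<close> follow from the bound on \<open>At \<circ> A\<close> and adjointness.\<close>

lemma bound_A_norm: "norm (A x) \<le> sqrt (\<kappa>1 / \<rho>) * norm x"
proof -
  have "norm (A x) \<le> sqrt (\<kappa>1 * (norm x)\<^sup>2 / \<rho>)"
    by (rule norm_le_sqrt[OF rho_pos bound_A])
  then show ?thesis
    by (simp add: real_sqrt_mult real_sqrt_divide)
qed

lemma bound_At: "norm (At y) \<le> sqrt (\<kappa>1 / \<rho>) * norm y"
proof (cases "At y = 0")
  case False
  have "norm (At y) * norm (At y) = inner (A (At y)) y"
    by (simp add: adjA flip: power2_norm_eq_inner power2_eq_square)
  also have "\<dots> \<le> norm (A (At y)) * norm y"
    by (rule norm_cauchy_schwarz)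
  also have "\<dots> \<le> sqrt (\<kappa>1 / \<rho>) * norm (At y) * norm y"
    by (rule mult_right_mono[OF bound_A_norm]) simp
  also have "\<dots> = (sqrt (\<kappa>1 / \<rho>) * norm y) * norm (At y)" by simp
  finally show ?thesis
    using False by simp
next
  case True
  then show ?thesis
    using kappa1_nonneg rho_pos by simp
qed

text \<open>
  The multiplier is bounded by a constant plus a multiple of \<open>r k = norm (A (W k) + B (P k))\<close>, and
  the merit bounds \<open>f (z k) + \<rho> / 2 * (r k)\<^sup>2\<close> by a constant plus a multiple of \<open>norm (u k)\<close>. A
  quadratic bounded by a linear function gives \<open>r k \<le> R\<close>, and the remaining bounds follow in the
  order \<open>u\<close>, \<open>z\<close>, \<open>W\<close>, \<open>P\<close>. The increments are bounded from that
  between the iterates 1 and 2 on, whence the shift by two.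
\<close>

theorem bounded:
  "\<exists>K. \<forall>k. norm (W k) \<le> K \<and> norm (P k) \<le> K \<and> norm (z k) \<le> K \<and> norm (u k) \<le> K"
proof -
  define a where "a = sqrt (merit 0 / rateW)"
  define b where "b = sqrt (merit 0 / (1 / (\<sigma> * \<beta>)))"
  define s where "s = sqrt (\<kappa>1 / \<rho>)"
  define C where "C = b + (b + \<sigma> * \<tau> * a) / \<sigma> + \<kappa>1 * a"
  define D where "D = 1 / (\<sigma> * \<beta>) * b"
  define r where "r k = norm (A (W k) + B (P k))" for k
  define R where "R = max 1 ((merit 0 + D * C + D * (\<rho> * s)) / (\<rho> / 2))"
  have pos: "0 \<le> a" "0 \<le> b" "0 \<le> s" "0 \<le> C" "0 \<le> D"
    using merit_nonneg[of 0] rateW_pos sigma_pos beta_pos kappa1_nonneg rho_pos tau_pos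
    by (auto simp: a_def b_def s_def C_def D_def)
  have u_bound: "norm (u (Suc (Suc k))) \<le> C + \<rho> * s * r (Suc (Suc k))" for k
  proof -
    let ?k = "Suc k"
    have dW: "norm (dW ?k) \<le> a" and du: "norm (du ?k) \<le> b"
      using increments_bounded[of k] by (simp_all add: a_def b_def)
    have "norm (resid ?k) \<le> norm (du ?k) + \<bar>\<sigma> * (\<tau> - \<beta>)\<bar> * norm (dW ?k)"
      unfolding du_resid by (metis norm_scaleR norm_triangle_ineq)
    also have "\<bar>\<sigma> * (\<tau> - \<beta>)\<bar> * norm (dW ?k) \<le> \<sigma> * \<tau> * a"
      using tau_large beta_pos sigma_pos dW unfolding abs_mult by (intro mult_mono) auto
    finally have e: "norm (resid ?k) \<le> b + \<sigma> * \<tau> * a"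
      using du by linarith
    \<comment> \<open>The gradient is taken at the old \<open>W\<close>; moving it to the new one costs a multiple of \<open>dW\<close>.\<close>
    have G: "coupling_grad (W ?k) (P (Suc ?k))
        = \<rho> *\<^sub>R At (A (W (Suc ?k)) + B (P (Suc ?k))) - \<rho> *\<^sub>R At (A (dW ?k))"
    proof -
      have "At (B 0) = 0"
        by (simp add: linear_0[OF linB] linear_0[OF linAt])
      then show ?thesis
        using coupling_grad_diff[of "W (Suc ?k)" "P (Suc ?k)" "W ?k" "P (Suc ?k)"]
        by (simp add: coupling_grad_def dW_def algebra_simps)
    qed
    have "u (Suc ?k) = du ?k - (1 / \<sigma>) *\<^sub>R resid ?k - coupling_grad (W ?k) (P (Suc ?k))"
      unfolding du_def resid_def using sigma_pos by (simp add: algebra_simps)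
    also have "\<dots> = du ?k - (1 / \<sigma>) *\<^sub>R resid ?k
        - \<rho> *\<^sub>R At (A (W (Suc ?k)) + B (P (Suc ?k))) + \<rho> *\<^sub>R At (A (dW ?k))"
      unfolding G by simp
    also have "norm \<dots> \<le> norm (du ?k) + norm ((1 / \<sigma>) *\<^sub>R resid ?k)
        + norm (\<rho> *\<^sub>R At (A (W (Suc ?k)) + B (P (Suc ?k)))) + norm (\<rho> *\<^sub>R At (A (dW ?k)))"
      by (intro order_trans[OF norm_triangle_ineq] order_trans[OF norm_triangle_ineq4] add_right_mono
          order_refl)
    also have "norm ((1 / \<sigma>) *\<^sub>R resid ?k) \<le> (b + \<sigma> * \<tau> * a) / \<sigma>"
      using e sigma_pos by (simp add: divide_right_mono)
    also have "norm (\<rho> *\<^sub>R At (A (W (Suc ?k)) + B (P (Suc ?k)))) \<le> \<rho> * s * r (Suc ?k)"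
      using bound_At[of "A (W (Suc ?k)) + B (P (Suc ?k))"] rho_pos
      by (simp add: r_def s_def mult.assoc)
    also have "norm (\<rho> *\<^sub>R At (A (dW ?k))) \<le> \<kappa>1 * a"
      using bound_AtA[of "dW ?k"] mult_left_mono[OF dW kappa1_nonneg] rho_pos by simp
    finally show ?thesis
      using du by (simp add: C_def)
  qed
  have gap: "norm (W (Suc (Suc k)) - z (Suc (Suc k))) \<le> D" for k
  proof -
    have "norm (du (Suc k)) \<le> b"
      unfolding b_def by (rule increments_bounded(2))
    then show ?thesis
      unfolding primal_gap D_def norm_scaleR using sigma_pos beta_pos
      by (intro mult_mono) auto
  qed
  have energy: "f (z (Suc (Suc k))) + \<rho> / 2 * (r (Suc (Suc k)))\<^sup>2 \<le> merit 0 + D * norm (u (Suc (Suc k)))"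
    for k
  proof -
    let ?k = "Suc (Suc k)"
    have "lagrangian ?k \<le> merit (Suc k)"
      unfolding merit_def using weights_nonneg by simp
    also have "\<dots> \<le> merit 0"
      by (rule merit_antimono) simp
    finally have 1: "lagrangian ?k \<le> merit 0" .
    have "- inner (u ?k) (W ?k - z ?k) \<le> norm (u ?k) * norm (W ?k - z ?k)"
      using Cauchy_Schwarz_ineq2[of "u ?k" "W ?k - z ?k"] by linarith
    also have "\<dots> \<le> norm (u ?k) * D"
      by (rule mult_left_mono[OF gap]) simp
    finally have 2: "- inner (u ?k) (W ?k - z ?k) \<le> D * norm (u ?k)"
      by (simp add: mult.commute)
    have 3: "\<beta> / 2 * (norm (W ?k - z ?k))\<^sup>2 \<ge> 0"
      using beta_pos by simp
    show ?thesis
      using 1 2 3 g_nonneg[of ?k] unfolding lagrangian_def coupling_def r_def by linarith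
  qed
  have r_bound: "r (Suc (Suc k)) \<le> R" for k
    unfolding R_def
  proof (rule quadratic_bound)
    let ?k = "Suc (Suc k)"
    have "\<rho> / 2 * (r ?k)\<^sup>2 \<le> merit 0 + D * norm (u ?k)"
      using energy[of k] f_nonneg[of "Suc k"] by simp
    also have "\<dots> \<le> merit 0 + D * (C + \<rho> * s * r ?k)"
      using u_bound[of k] pos by (simp add: mult_left_mono)
    finally show "\<rho> / 2 * (r ?k)\<^sup>2 \<le> merit 0 + D * C + D * (\<rho> * s) * r ?k"
      by (simp add: algebra_simps)
  qed (use pos merit_nonneg[of 0] rho_pos in \<open>auto simp: r_def\<close>)
  define U where "U = C + \<rho> * s * R"
  have U: "norm (u (Suc (Suc k))) \<le> U" for k
  proof -
    have "\<rho> * s * r (Suc (Suc k)) \<le> \<rho> * s * R"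
      using pos rho_pos by (intro mult_left_mono r_bound) auto
    then show ?thesis
      using u_bound[of k] by (simp add: U_def)
  qed
  define Z where "Z = cf * (merit 0 + D * U)"
  have Z: "norm (z (Suc (Suc k))) \<le> Z" for k
  proof -
    let ?k = "Suc (Suc k)"
    have "\<rho> / 2 * (r ?k)\<^sup>2 \<ge> 0"
      using rho_pos by simp
    then have "f (z ?k) \<le> merit 0 + D * U"
      using energy[of k] mult_left_mono[OF U[of k] pos(5)] by linarith
    then show ?thesis
      unfolding Z_def using f_coercive[of "Suc k"] const_nonneg
      by (smt (verit) mult_left_mono)
  qed
  define X where "X = Z + D"
  have X: "norm (W (Suc (Suc k))) \<le> X" for k
    unfolding X_def using gap[of k] Z[of k] norm_triangle_sub[of "W (Suc (Suc k))" "z (Suc (Suc k))"]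
    by linarith
  define Y where "Y = cB * (R + s * X)"
  have Y: "norm (P (Suc (Suc k))) \<le> Y" for k
  proof -
    let ?k = "Suc (Suc k)"
    have "norm (B (P ?k)) \<le> r ?k + norm (A (W ?k))"
      unfolding r_def by (metis add_diff_cancel_left' norm_triangle_ineq4)
    also have "norm (A (W ?k)) \<le> s * X"
      using bound_A_norm[of "W ?k"] mult_left_mono[OF X[of k] pos(3)] by (simp add: s_def)
    finally have "norm (B (P ?k)) \<le> R + s * X"
      using r_bound[of k] by simp
    then show ?thesis
      unfolding Y_def using P_bound[of ?k] const_nonneg
      by (smt (verit) mult_left_mono)
  qed
  define m where "m k = max (max (norm (W k)) (norm (P k))) (max (norm (z k)) (norm (u k)))" for k
  define K where "K = max (max (m 0) (m 1)) (max (max X Y) (max Z U))"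
  have "m k \<le> K" for k
  proof -
    consider "k = 0" | "k = 1" | i where "k = Suc (Suc i)"
      by (metis One_nat_def not0_implies_Suc)
    then show ?thesis
    proof cases
      case 3
      have "m k \<le> max (max X Y) (max Z U)"
        unfolding m_def 3 by (intro max.mono X Y Z U)
      then show ?thesis
        by (simp add: K_def)
    qed (simp_all add: K_def)
  qed
  then have "norm (W k) \<le> K \<and> norm (P k) \<le> K \<and> norm (z k) \<le> K \<and> norm (u k) \<le> K" for k
    by (simp add: m_def)
  then show ?thesis
    by blast
qed

end

section \<open>Vectors as finitely supported sequences\<close>

text \<open>
  Real sequences with finite support form one real inner product space that contains the
  Euclidean space of every dimension.
\<close>

typedef finseq = "{x :: nat \<Rightarrow> real. finite {i. x i \<noteq> 0}}"
  morphisms coord Finseq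
  by (rule exI[of _ "\<lambda>_. 0"]) simp

setup_lifting type_definition_finseq

lemma finseq_eqI: "(\<And>i. coord x i = coord y i) \<Longrightarrow> x = y"
  by (metis coord_inject ext)

lemma finite_support: "finite {i. coord x i \<noteq> 0}"
  using coord[of x] by simp

instantiation finseq :: real_inner
begin

lift_definition zero_finseq :: finseq is "\<lambda>_. 0"
  by simp

lift_definition plus_finseq :: "finseq \<Rightarrow> finseq \<Rightarrow> finseq" is "\<lambda>x y i. x i + y i"
  by (erule (1) finite_subset[OF _ finite_UnI, rotated]) auto

lift_definition uminus_finseq :: "finseq \<Rightarrow> finseq" is "\<lambda>x i. - x i"
  by simp

lift_definition minus_finseq :: "finseq \<Rightarrow> finseq \<Rightarrow> finseq" is "\<lambda>x y i. x i - y i"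
  by (erule (1) finite_subset[OF _ finite_UnI, rotated]) auto

lift_definition scaleR_finseq :: "real \<Rightarrow> finseq \<Rightarrow> finseq" is "\<lambda>c x i. c * x i"
  by (erule finite_subset[rotated]) auto

definition inner_finseq :: "finseq \<Rightarrow> finseq \<Rightarrow> real" where
  "inner_finseq x y = (\<Sum>i | coord x i \<noteq> 0. coord x i * coord y i)"

definition norm_finseq :: "finseq \<Rightarrow> real" where
  "norm_finseq x = sqrt (inner x x)"

definition dist_finseq :: "finseq \<Rightarrow> finseq \<Rightarrow> real" where
  "dist_finseq x y = norm (x - y)"

definition sgn_finseq :: "finseq \<Rightarrow> finseq" where
  "sgn_finseq x = inverse (norm x) *\<^sub>R x"

definition uniformity_finseq :: "(finseq \<times> finseq) filter" where
  "uniformity_finseq = (INF e\<in>{0<..}. principal {(x, y). dist x y < e})"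

definition open_finseq :: "finseq set \<Rightarrow> bool" where
  "open_finseq U = (\<forall>x\<in>U. \<forall>\<^sub>F (x', y) in uniformity. x' = x \<longrightarrow> y \<in> U)"

lemma inner_finseq_superset:
  "finite S \<Longrightarrow> {i. coord x i \<noteq> 0} \<subseteq> S \<Longrightarrow> inner x y = (\<Sum>i\<in>S. coord x i * coord y i)"
  for x y :: finseq
  unfolding inner_finseq_def by (rule sum.mono_neutral_left) auto

instance
proof
  fix x y w :: finseq and a b :: real
  show "x + y + w = x + (y + w)" "x + y = y + x" "0 + x = x" "- x + x = 0" "x - y = x + - y"
    "a *\<^sub>R (x + y) = a *\<^sub>R x + a *\<^sub>R y" "(a + b) *\<^sub>R x = a *\<^sub>R x + b *\<^sub>R x"
    "a *\<^sub>R b *\<^sub>R x = (a * b) *\<^sub>R x" "1 *\<^sub>R x = x"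
    by (transfer; simp add: algebra_simps)+
  let ?S = "{i. coord x i \<noteq> 0} \<union> {i. coord y i \<noteq> 0}"
  have S: "finite ?S"
    by (simp add: finite_support)
  show "inner x y = inner y x"
    using inner_finseq_superset[OF S, of x y] inner_finseq_superset[OF S, of y x]
    by (simp add: mult.commute)
  have "inner (x + y) w = (\<Sum>i\<in>?S. coord (x + y) i * coord w i)"
    by (rule inner_finseq_superset[OF S]) (auto simp: plus_finseq.rep_eq)
  then show "inner (x + y) w = inner x w + inner y w"
    using inner_finseq_superset[OF S, of x w] inner_finseq_superset[OF S, of y w]
    by (simp add: plus_finseq.rep_eq distrib_right sum.distrib)
  have "inner (a *\<^sub>R x) y = (\<Sum>i\<in>?S. coord (a *\<^sub>R x) i * coord y i)"
    by (rule inner_finseq_superset[OF S]) (auto simp: scaleR_finseq.rep_eq)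
  then show "inner (a *\<^sub>R x) y = a * inner x y"
    using inner_finseq_superset[OF S, of x y]
    by (simp add: scaleR_finseq.rep_eq sum_distrib_left mult.assoc)
  show "0 \<le> inner x x"
    unfolding inner_finseq_def by (rule sum_nonneg) simp
  have "inner x x = 0 \<longleftrightarrow> (\<forall>i. coord x i = 0)"
    unfolding inner_finseq_def by (subst sum_nonneg_eq_0_iff) (auto simp: finite_support)
  then show "inner x x = 0 \<longleftrightarrow> x = 0"
    by (auto intro: finseq_eqI simp: zero_finseq.rep_eq)
qed (simp_all add: norm_finseq_def dist_finseq_def sgn_finseq_def uniformity_finseq_def
    open_finseq_def)

end

text \<open>
  A vector is continued by zeros, and a sequence is cut off to its first \<open>d\<close> coordinates. The
  embedding is additive only on vectors of equal dimension.
\<close>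

definition embed :: "real vec \<Rightarrow> finseq" where
  "embed v = Finseq (\<lambda>i. if i < dim_vec v then v $ i else 0)"

definition truncate :: "nat \<Rightarrow> finseq \<Rightarrow> real vec" where
  "truncate d x = vec d (coord x)"

lemma coord_embed: "coord (embed v) i = (if i < dim_vec v then v $ i else 0)"
proof -
  have "finite {i. (if i < dim_vec v then v $ i else 0) \<noteq> 0}"
    by (rule finite_subset[of _ "{..<dim_vec v}"]) auto
  then show ?thesis
    unfolding embed_def by (subst Finseq_inverse) auto
qed

lemma truncate_carrier [simp]: "truncate d x \<in> carrier_vec d"
  by (simp add: truncate_def)

lemma dim_truncate [simp]: "dim_vec (truncate d x) = d"
  by (simp add: truncate_def)

lemma truncate_embed: "v \<in> carrier_vec d \<Longrightarrow> truncate d (embed v) = v"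
  by (rule eq_vecI) (auto simp: truncate_def coord_embed)

lemma truncate_add: "truncate d (x + y) = truncate d x + truncate d y"
  by (rule eq_vecI) (auto simp: truncate_def plus_finseq.rep_eq)

lemma truncate_scaleR: "truncate d (c *\<^sub>R x) = c \<cdot>\<^sub>v truncate d x"
  by (rule eq_vecI) (auto simp: truncate_def scaleR_finseq.rep_eq)

lemma embed_add: "dim_vec v = dim_vec w \<Longrightarrow> embed (v + w) = embed v + embed w"
  by (rule finseq_eqI) (auto simp: coord_embed plus_finseq.rep_eq)

lemma embed_diff: "dim_vec v = dim_vec w \<Longrightarrow> embed (v - w) = embed v - embed w"
  by (rule finseq_eqI) (auto simp: coord_embed minus_finseq.rep_eq)

lemma embed_smult: "embed (c \<cdot>\<^sub>v v) = c *\<^sub>R embed v"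
  by (rule finseq_eqI) (auto simp: coord_embed scaleR_finseq.rep_eq)

lemma inner_embed: "inner (embed v) x = v \<bullet> truncate (dim_vec v) x"
proof -
  have "inner (embed v) x = (\<Sum>i<dim_vec v. coord (embed v) i * coord x i)"
    by (rule inner_finseq_superset) (auto simp: coord_embed split: if_splits)
  then show ?thesis
    by (simp add: scalar_prod_def coord_embed truncate_def atLeast0LessThan)
qed

lemma norm_embed: "norm (embed v) = vnorm v"
  unfolding norm_finseq_def vnorm_def inner_embed by (simp add: truncate_embed)

lemma vnorm_sq: "(vnorm v)\<^sup>2 = v \<bullet> v"
proof -
  have "v \<bullet> v \<ge> 0"
    unfolding scalar_prod_def by (rule sum_nonneg) simp
  then show ?thesis
    by (simp add: vnorm_def)
qed

lemma vnorm_nonneg [simp]: "vnorm v \<ge> 0"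
  by (metis norm_embed norm_ge_zero)

lemma vnorm_truncate: "vnorm (truncate d x) \<le> norm x"
proof -
  have "(norm (embed (truncate d x)))\<^sup>2 = inner (embed (truncate d x)) x"
    by (simp add: power2_norm_eq_inner inner_embed truncate_embed)
  also have "\<dots> \<le> norm (embed (truncate d x)) * norm x"
    by (rule norm_cauchy_schwarz)
  finally show ?thesis
    unfolding norm_embed power2_eq_square
    by (metis mult_le_cancel_left_pos norm_ge_zero not_less vnorm_nonneg order.trans less_eq_real_def)
qed

text \<open>
  The linear operator of a matrix on sequences: cut off to the number of columns, multiply, and
  continue by zeros. It has the operator of the transpose as its adjoint.
\<close>

definition mat_op :: "real mat \<Rightarrow> finseq \<Rightarrow> finseq" where
  "mat_op M x = embed (M *\<^sub>v truncate (dim_col M) x)"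

lemma mat_op_embed: "v \<in> carrier_vec (dim_col M) \<Longrightarrow> mat_op M (embed v) = embed (M *\<^sub>v v)"
  by (simp add: mat_op_def truncate_embed)

lemma mat_op_mult:
  assumes "dim_col M = dim_row N"
  shows "mat_op M (mat_op N x) = mat_op (M * N) x"
proof -
  have M: "M \<in> carrier_mat (dim_row M) (dim_row N)" and N: "N \<in> carrier_mat (dim_row N) (dim_col N)"
    using assms by auto
  have "N *\<^sub>v truncate (dim_col N) x \<in> carrier_vec (dim_col M)"
    using assms by (intro carrier_vecI) simp
  then have "mat_op M (mat_op N x) = embed (M *\<^sub>v (N *\<^sub>v truncate (dim_col N) x))"
    by (simp only: mat_op_def[of N] mat_op_embed)
  also have "M *\<^sub>v (N *\<^sub>v truncate (dim_col N) x) = (M * N) *\<^sub>v truncate (dim_col N) x"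
    by (rule assoc_mult_mat_vec[OF M N truncate_carrier, symmetric])
  also have "embed \<dots> = mat_op (M * N) x"
    by (simp only: mat_op_def index_mult_mat(3))
  finally show ?thesis .
qed

lemma linear_mat_op: "linear (mat_op M)"
proof (rule linearI)
  have M: "M \<in> carrier_mat (dim_row M) (dim_col M)"
    by simp
  show "mat_op M (x + y) = mat_op M x + mat_op M y" for x y
    unfolding mat_op_def truncate_add
    by (simp add: mult_add_distrib_mat_vec[OF M truncate_carrier truncate_carrier] embed_add)
  show "mat_op M (c *\<^sub>R x) = c *\<^sub>R mat_op M x" for c x
    unfolding mat_op_def truncate_scaleR
    by (simp add: mult_mat_vec[OF M truncate_carrier] embed_smult)
qed

lemma inner_mat_op: "inner (mat_op M x) y = inner x (mat_op (transpose_mat M) y)"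
proof -
  let ?x = "truncate (dim_col M) x" and ?y = "truncate (dim_row M) y"
  have "inner (mat_op M x) y = (M *\<^sub>v ?x) \<bullet> ?y"
    by (simp add: mat_op_def inner_embed)
  also have "\<dots> = ?y \<bullet> (M *\<^sub>v ?x)"
    by (rule comm_scalar_prod[of _ "dim_row M"]) (auto intro: carrier_vecI)
  also have "\<dots> = (transpose_mat M *\<^sub>v ?y) \<bullet> ?x"
    by (rule transpose_vec_mult_scalar[symmetric, of _ "dim_row M" "dim_col M"]) auto
  also have "\<dots> = inner (mat_op (transpose_mat M) y) x"
    by (simp add: mat_op_def inner_embed)
  finally show ?thesis
    by (simp add: inner_commute)
qed

section \<open>Spectral norm, gradients and proximal points\<close>

lemma vnorm_smult: "vnorm (c \<cdot>\<^sub>v v) = \<bar>c\<bar> * vnorm v"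
  by (metis embed_smult norm_embed norm_scaleR)

text \<open>A crude (Frobenius) bound, needed to know that the supremum in the spectral norm is finite.\<close>

lemma mult_mat_vec_bounded: "\<exists>c. \<forall>v\<in>carrier_vec (dim_col M). vnorm (M *\<^sub>v v) \<le> c * vnorm v"
proof (intro exI ballI)
  let ?c = "sqrt (\<Sum>i<dim_row M. (vnorm (row M i))\<^sup>2)"
  fix v :: "real vec" assume v: "v \<in> carrier_vec (dim_col M)"
  have row: "(row M i \<bullet> v)\<^sup>2 \<le> (vnorm (row M i))\<^sup>2 * (vnorm v)\<^sup>2" if "i < dim_row M" for i
  proof -
    have "row M i \<bullet> v = inner (embed (row M i)) (embed v)"
      using v by (simp add: inner_embed truncate_embed)
    then have "\<bar>row M i \<bullet> v\<bar> \<le> vnorm (row M i) * vnorm v"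
      using Cauchy_Schwarz_ineq2[of "embed (row M i)" "embed v"] by (simp add: norm_embed)
    then show ?thesis
      by (metis abs_ge_zero power2_abs power_mono power_mult_distrib)
  qed
  have "(vnorm (M *\<^sub>v v))\<^sup>2 = (\<Sum>i<dim_row M. (row M i \<bullet> v)\<^sup>2)"
    unfolding vnorm_sq scalar_prod_def[of "M *\<^sub>v v" "M *\<^sub>v v"]
    by (simp add: atLeast0LessThan power2_eq_square)
  also have "\<dots> \<le> (\<Sum>i<dim_row M. (vnorm (row M i))\<^sup>2 * (vnorm v)\<^sup>2)"
    by (rule sum_mono) (simp add: row)
  also have "\<dots> = (?c * vnorm v)\<^sup>2"
    by (simp add: sum_distrib_right[symmetric] power_mult_distrib sum_nonneg)
  finally show "vnorm (M *\<^sub>v v) \<le> ?c * vnorm v"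
    by (rule power2_le_imp_le) (simp add: sum_nonneg)
qed

lemma spectral_norm_nonneg: "spectral_norm M \<ge> 0"
  and spectral_norm_bound: "v \<in> carrier_vec (dim_col M) \<Longrightarrow> vnorm (M *\<^sub>v v) \<le> spectral_norm M * vnorm v"
proof -
  let ?S = "{vnorm (M *\<^sub>v x) | x. x \<in> carrier_vec (dim_col M) \<and> vnorm x \<le> 1}"
  obtain c where c: "\<And>v. v \<in> carrier_vec (dim_col M) \<Longrightarrow> vnorm (M *\<^sub>v v) \<le> c * vnorm v"
    using mult_mat_vec_bounded by blast
  have bdd: "bdd_above ?S"
  proof (rule bdd_aboveI)
    fix r assume "r \<in> ?S"
    then obtain x where x: "r = vnorm (M *\<^sub>v x)" "x \<in> carrier_vec (dim_col M)" "vnorm x \<le> 1"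
      by blast
    have "r \<le> c * vnorm x"
      using c x by simp
    also have "\<dots> \<le> \<bar>c\<bar> * 1"
      using x by (intro mult_mono) auto
    finally show "r \<le> \<bar>c\<bar>" by simp
  qed
  have upper: "vnorm (M *\<^sub>v x) \<le> spectral_norm M" if "x \<in> carrier_vec (dim_col M)" "vnorm x \<le> 1" for x
    unfolding spectral_norm_def using that by (intro cSup_upper[OF _ bdd]) blast
  have "vnorm (0\<^sub>v (dim_col M)) \<le> 1"
    by (simp add: vnorm_def)
  then show "spectral_norm M \<ge> 0"
    using upper[of "0\<^sub>v (dim_col M)"] order_trans[OF vnorm_nonneg] by simp
  assume v: "v \<in> carrier_vec (dim_col M)"
  show "vnorm (M *\<^sub>v v) \<le> spectral_norm M * vnorm v"
  proof (cases "vnorm v = 0")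
    case True
    then show ?thesis
      using c[OF v] by simp
  next
    case False
    then have pos: "vnorm v > 0"
      using vnorm_nonneg[of v] by linarith
    have "M *\<^sub>v ((1 / vnorm v) \<cdot>\<^sub>v v) = (1 / vnorm v) \<cdot>\<^sub>v (M *\<^sub>v v)"
      using v by (intro mult_mat_vec[of M "dim_row M" "dim_col M"]) auto
    then have "1 / vnorm v * vnorm (M *\<^sub>v v) \<le> spectral_norm M"
      using upper[of "(1 / vnorm v) \<cdot>\<^sub>v v"] v pos by (simp add: vnorm_smult)
    then show ?thesis
      using pos by (simp add: field_simps)
  qed
qed

lemma norm_mat_op: "norm (mat_op M x) \<le> spectral_norm M * norm x"
proof -
  have "norm (mat_op M x) \<le> spectral_norm M * vnorm (truncate (dim_col M) x)"
    unfolding mat_op_def norm_embed by (rule spectral_norm_bound) simp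
  also have "\<dots> \<le> spectral_norm M * norm x"
    by (rule mult_left_mono[OF vnorm_truncate spectral_norm_nonneg])
  finally show ?thesis .
qed

lemma gradient_least_squares:
  assumes M: "M \<in> carrier_mat r d" and b: "b \<in> carrier_vec r" and x: "x \<in> carrier_vec d"
  shows "gradient d (\<lambda>w. \<rho> / 2 * (vnorm (M *\<^sub>v w + b))\<^sup>2) x
    = \<rho> \<cdot>\<^sub>v (transpose_mat M *\<^sub>v (M *\<^sub>v x + b))"
proof (rule eq_vecI)
  define c where "c = M *\<^sub>v x + b"
  have c: "c \<in> carrier_vec r"
    using M b by (intro carrier_vecI) (simp add: c_def)
  fix i assume "i < dim_vec (\<rho> \<cdot>\<^sub>v (transpose_mat M *\<^sub>v (M *\<^sub>v x + b)))"
  then have i: "i < d"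
    using M by simp
  define a where "a = M *\<^sub>v unit_vec d i"
  have a: "a \<in> carrier_vec r"
    using M by (intro carrier_vecI) (simp add: a_def)
  have eq: "\<rho> / 2 * (vnorm (M *\<^sub>v (x + s \<cdot>\<^sub>v unit_vec d i) + b))\<^sup>2
      = \<rho> / 2 * (c \<bullet> c) + \<rho> * (c \<bullet> a) * s + \<rho> / 2 * (a \<bullet> a) * s\<^sup>2" for s
  proof -
    have "M *\<^sub>v (x + s \<cdot>\<^sub>v unit_vec d i) = M *\<^sub>v x + s \<cdot>\<^sub>v a"
      unfolding a_def using M x
      by (subst mult_add_distrib_mat_vec[OF M]) (auto simp: mult_mat_vec[OF M])
    then have "M *\<^sub>v (x + s \<cdot>\<^sub>v unit_vec d i) + b = c + s \<cdot>\<^sub>v a"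
      unfolding c_def using M b a by (intro eq_vecI) auto
    moreover have "(vnorm (c + s \<cdot>\<^sub>v a))\<^sup>2 = c \<bullet> c + 2 * s * (c \<bullet> a) + s\<^sup>2 * (a \<bullet> a)"
    proof -
      have sa: "s \<cdot>\<^sub>v a \<in> carrier_vec r"
        using a by simp
      have "(c + s \<cdot>\<^sub>v a) \<bullet> (c + s \<cdot>\<^sub>v a) = c \<bullet> c + s * (c \<bullet> a) + (s * (c \<bullet> a) + s * (s * (a \<bullet> a)))"
        using a c sa
        by (simp only: add_scalar_prod_distrib[OF c sa add_carrier_vec[OF c sa]]
            scalar_prod_add_distrib[OF c c sa] scalar_prod_add_distrib[OF sa c sa]
            smult_scalar_prod_distrib[OF a c] smult_scalar_prod_distrib[OF a sa]
            scalar_prod_smult_distrib[OF c a] scalar_prod_smult_distrib[OF a a]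
            comm_scalar_prod[OF a c])
      then show ?thesis
        unfolding vnorm_sq by (simp add: power2_eq_square)
    qed
    ultimately show ?thesis
      by (simp add: distrib_left)
  qed
  have "((\<lambda>s. \<rho> / 2 * (c \<bullet> c) + \<rho> * (c \<bullet> a) * s + \<rho> / 2 * (a \<bullet> a) * s\<^sup>2)
      has_field_derivative \<rho> * (c \<bullet> a)) (at 0)"
    by (rule derivative_eq_intros refl | simp)+
  then have "gradient d (\<lambda>w. \<rho> / 2 * (vnorm (M *\<^sub>v w + b))\<^sup>2) x $ i = \<rho> * (c \<bullet> a)"
    unfolding gradient_def using i by (simp only: eq index_vec DERIV_imp_deriv)
  also have "c \<bullet> a = (transpose_mat M *\<^sub>v c) \<bullet> unit_vec d i"
    unfolding a_def by (rule transpose_vec_mult_scalar[OF M _ c, symmetric]) simp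
  also have "\<dots> = (transpose_mat M *\<^sub>v c) $ i"
    using i by (rule scalar_prod_right_unit)
  finally show "gradient d (\<lambda>w. \<rho> / 2 * (vnorm (M *\<^sub>v w + b))\<^sup>2) x $ i
      = (\<rho> \<cdot>\<^sub>v (transpose_mat M *\<^sub>v (M *\<^sub>v x + b))) $ i"
    using i M unfolding c_def by simp
qed (use M in \<open>simp add: gradient_def\<close>)

lemma proxD:
  assumes "y \<in> prox d (1 / \<alpha>) h v"
  shows "y \<in> carrier_vec d"
    and "x \<in> carrier_vec d \<Longrightarrow>
      h y + ereal (\<alpha> / 2 * (vnorm (y - v))\<^sup>2) \<le> h x + ereal (\<alpha> / 2 * (vnorm (x - v))\<^sup>2)"
proof -
  have *: "1 / (2 * (1 / \<alpha>)) = \<alpha> / 2"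
    by simp
  have "is_arg_min (\<lambda>y. h y + ereal (\<alpha> / 2 * (vnorm (y - v))\<^sup>2)) (\<lambda>y. y \<in> carrier_vec d) y"
    using assms unfolding prox_def mem_Collect_eq * .
  then have y: "y \<in> carrier_vec d"
    and *: "\<not> (\<exists>x. x \<in> carrier_vec d \<and>
      h x + ereal (\<alpha> / 2 * (vnorm (x - v))\<^sup>2) < h y + ereal (\<alpha> / 2 * (vnorm (y - v))\<^sup>2))"
    unfolding is_arg_min_def by blast+
  show "y \<in> carrier_vec d"
    by (rule y)
  show "h y + ereal (\<alpha> / 2 * (vnorm (y - v))\<^sup>2) \<le> h x + ereal (\<alpha> / 2 * (vnorm (x - v))\<^sup>2)"
    if "x \<in> carrier_vec d"
    using * that not_less by blast
qed

section \<open>Coercivity on the cone of positive semidefinite matrices\<close>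

lemma pos_def_imp_pos_semidef: "pos_def k S \<Longrightarrow> pos_semidef k S"
proof -
  assume S: "pos_def k S"
  have "x \<bullet> (S *\<^sub>v x) \<ge> 0" if x: "x \<in> carrier_vec k" for x
  proof (cases "x = 0\<^sub>v k")
    case True
    have "S *\<^sub>v x \<in> carrier_vec k"
      using S x unfolding pos_def_def by (auto intro: mult_mat_vec_carrier)
    then show ?thesis
      using True by simp
  next
    case False
    then show ?thesis
      using S x unfolding pos_def_def by force
  qed
  then show ?thesis
    using S unfolding pos_def_def pos_semidef_def by blast
qed

lemma sum_mod_div:
  fixes h :: "nat \<Rightarrow> nat \<Rightarrow> real"
  shows "(\<Sum>k<r * c. h (k mod r) (k div r)) = (\<Sum>i<r. \<Sum>j<c. h i j)"
  unfolding sum.cartesian_product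
proof (rule sum.reindex_bij_witness[of _ "\<lambda>(i, j). j * r + i" "\<lambda>k. (k mod r, k div r)"])
  fix k assume "k \<in> {..<r * c}"
  then have k: "k < r * c"
    by simp
  then have "r > 0"
    by (cases r) auto
  with k show "(k mod r, k div r) \<in> {..<r} \<times> {..<c}"
    by (simp add: less_mult_imp_div_less mult.commute)
next
  fix x assume "x \<in> {..<r} \<times> {..<c}"
  then obtain i j where x: "x = (i, j)" "i < r" "j < c"
    by auto
  have "j * r + i < Suc j * r"
    using x by simp
  also have "\<dots> \<le> c * r"
    using x by (intro mult_le_mono1) simp
  finally show "(case x of (i, j) \<Rightarrow> j * r + i) \<in> {..<r * c}"
    by (simp add: x mult.commute)
qed auto

lemma vectorize_scalar_prod:
  assumes "X \<in> carrier_mat r c" "Y \<in> carrier_mat r c"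
  shows "vectorize X \<bullet> vectorize Y = (\<Sum>i<r. \<Sum>j<c. X $$ (i, j) * Y $$ (i, j))"
proof -
  have "vectorize X \<bullet> vectorize Y
      = (\<Sum>k<r * c. X $$ (k mod r, k div r) * Y $$ (k mod r, k div r))"
    using assms unfolding vectorize_def scalar_prod_def by (simp add: atLeast0LessThan)
  also have "\<dots> = (\<Sum>i<r. \<Sum>j<c. X $$ (i, j) * Y $$ (i, j))"
    by (rule sum_mod_div)
  finally show ?thesis .
qed

lemma vectorize_carrier: "X \<in> carrier_mat r c \<Longrightarrow> vectorize X \<in> carrier_vec (r * c)"
  by (auto simp: vectorize_def carrier_vecI)

lemma unvectorize_vectorize:
  assumes X: "X \<in> carrier_mat r c"
  shows "unvectorize r c (vectorize X) = X"
proof (rule eq_matI)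
  fix i j assume "i < dim_row X" "j < dim_col X"
  then have ij: "i < r" "j < c"
    using X by auto
  have "j * r + i < Suc j * r"
    using ij by simp
  also have "\<dots> \<le> c * r"
    using ij by (intro mult_le_mono1) simp
  finally have "j * r + i < r * c"
    by (simp add: mult.commute)
  then show "unvectorize r c (vectorize X) $$ (i, j) = X $$ (i, j)"
    using X ij by (simp add: unvectorize_def vectorize_def)
qed (use X in \<open>auto simp: unvectorize_def\<close>)

lemma pos_semidef_entries:
  assumes G: "pos_semidef k G" and i: "i < k" and j: "j < k"
  shows "G $$ (i, i) \<ge> 0" and "\<bar>G $$ (i, j)\<bar> \<le> (G $$ (i, i) + G $$ (j, j)) / 2"
proof -
  have carr: "G \<in> carrier_mat k k" and sym: "transpose_mat G = G"
    and nonneg: "\<And>x. x \<in> carrier_vec k \<Longrightarrow> x \<bullet> (G *\<^sub>v x) \<ge> 0"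
    using G unfolding pos_semidef_def by auto
  have entry: "unit_vec k a \<bullet> (G *\<^sub>v unit_vec k b) = G $$ (a, b)" if "a < k" "b < k" for a b
  proof -
    have "G *\<^sub>v unit_vec k b \<in> carrier_vec k"
      by (rule mult_mat_vec_carrier[OF carr unit_vec_carrier])
    then have "unit_vec k a \<bullet> (G *\<^sub>v unit_vec k b) = (G *\<^sub>v unit_vec k b) $ a"
      using that(1) by (rule scalar_prod_left_unit)
    also have "\<dots> = row G a \<bullet> unit_vec k b"
      using carr that by simp
    also have "\<dots> = row G a $ b"
      using that by simp
    finally show ?thesis
      using carr that by simp
  qed
  show "G $$ (i, i) \<ge> 0"
    using nonneg[of "unit_vec k i"] entry[OF i i] by simp
  have G_sym: "G $$ (j, i) = G $$ (i, j)"
    using arg_cong[OF sym, of "\<lambda>M. M $$ (i, j)"] carr i j by simp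
  have quad: "0 \<le> G $$ (i, i) + 2 * s * G $$ (i, j) + s * s * G $$ (j, j)" for s
  proof -
    let ?u = "unit_vec k i" and ?w = "s \<cdot>\<^sub>v unit_vec k j"
    have u: "?u \<in> carrier_vec k" and w: "?w \<in> carrier_vec k"
      by simp_all
    have Gu: "G *\<^sub>v ?u \<in> carrier_vec k"
      by (rule mult_mat_vec_carrier[OF carr u])
    have Gj: "G *\<^sub>v unit_vec k j \<in> carrier_vec k"
      by (rule mult_mat_vec_carrier[OF carr unit_vec_carrier])
    then have sGj: "s \<cdot>\<^sub>v (G *\<^sub>v unit_vec k j) \<in> carrier_vec k"
      by simp
    have "(?u + ?w) \<bullet> (G *\<^sub>v (?u + ?w)) = (?u + ?w) \<bullet> (G *\<^sub>v ?u + s \<cdot>\<^sub>v (G *\<^sub>v unit_vec k j))"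
      by (simp only: mult_add_distrib_mat_vec[OF carr u w] mult_mat_vec[OF carr unit_vec_carrier])
    also have "\<dots> = ?u \<bullet> (G *\<^sub>v ?u) + s * (?u \<bullet> (G *\<^sub>v unit_vec k j))
        + (s * (unit_vec k j \<bullet> (G *\<^sub>v ?u)) + s * (s * (unit_vec k j \<bullet> (G *\<^sub>v unit_vec k j))))"
      by (simp only: add_scalar_prod_distrib[OF u w add_carrier_vec[OF Gu sGj]]
          scalar_prod_add_distrib[OF u Gu sGj] scalar_prod_add_distrib[OF w Gu sGj]
          smult_scalar_prod_distrib[OF unit_vec_carrier Gu]
          smult_scalar_prod_distrib[OF unit_vec_carrier sGj]
          scalar_prod_smult_distrib[OF u Gj] scalar_prod_smult_distrib[OF unit_vec_carrier Gj])
    also have "\<dots> = G $$ (i, i) + 2 * s * G $$ (i, j) + s * s * G $$ (j, j)"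
      unfolding entry[OF i i] entry[OF i j] entry[OF j i] entry[OF j j] G_sym by simp
    finally show ?thesis
      using nonneg[OF add_carrier_vec[OF u w]] by simp
  qed
  show "\<bar>G $$ (i, j)\<bar> \<le> (G $$ (i, i) + G $$ (j, j)) / 2"
    using quad[of 1] quad[of "-1"] by (simp add: abs_le_iff)
qed

lemma pos_semidef_entry_le_trace:
  assumes G: "pos_semidef k G" and i: "i < k" and j: "j < k"
  shows "\<bar>G $$ (i, j)\<bar> \<le> (\<Sum>a<k. G $$ (a, a))"
proof -
  have "G $$ (a, a) \<le> (\<Sum>a<k. G $$ (a, a))" if "a < k" for a
    using that pos_semidef_entries(1)[OF G] by (intro member_le_sum) auto
  from this[OF i] this[OF j]
  have "(G $$ (i, i) + G $$ (j, j)) / 2 \<le> (\<Sum>a<k. G $$ (a, a))"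
    by simp
  with pos_semidef_entries(2)[OF G i j] show ?thesis
    by (rule order_trans)
qed

lemma pos_semidef_congruence:
  assumes S: "pos_semidef k S" and K: "K \<in> carrier_mat r k"
  shows "pos_semidef r (K * S * transpose_mat K)"
  unfolding pos_semidef_def
proof (intro conjI ballI)
  have carr: "S \<in> carrier_mat k k" and sym: "transpose_mat S = S"
    and nonneg: "\<And>x. x \<in> carrier_vec k \<Longrightarrow> x \<bullet> (S *\<^sub>v x) \<ge> 0"
    using S unfolding pos_semidef_def by auto
  have Kt: "transpose_mat K \<in> carrier_mat k r"
    using K by simp
  have KS: "K * S \<in> carrier_mat r k"
    using K carr by simp
  show "K * S * transpose_mat K \<in> carrier_mat r r"
    using KS Kt by (rule mult_carrier_mat)
  show "transpose_mat (K * S * transpose_mat K) = K * S * transpose_mat K"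
    unfolding transpose_mult[OF KS Kt] transpose_mult[OF K carr] sym transpose_transpose
    by (rule assoc_mult_mat[OF K carr Kt, symmetric])
  fix x :: "real vec" assume x: "x \<in> carrier_vec r"
  let ?y = "transpose_mat K *\<^sub>v x"
  have y: "?y \<in> carrier_vec k"
    by (rule mult_mat_vec_carrier[OF Kt x])
  have Sy: "S *\<^sub>v ?y \<in> carrier_vec k"
    by (rule mult_mat_vec_carrier[OF carr y])
  have "K * S * transpose_mat K *\<^sub>v x = K *\<^sub>v (S *\<^sub>v ?y)"
    by (simp only: assoc_mult_mat_vec[OF KS Kt x] assoc_mult_mat_vec[OF K carr y])
  then have "x \<bullet> (K * S * transpose_mat K *\<^sub>v x) = ?y \<bullet> (S *\<^sub>v ?y)"
    by (simp only: transpose_vec_mult_scalar[OF K Sy x])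
  then show "x \<bullet> (K * S * transpose_mat K *\<^sub>v x) \<ge> 0"
    using nonneg[OF y] by simp
qed

lemma mult_mat_entry:
  fixes X Y :: "real mat"
  assumes "X \<in> carrier_mat r k" "Y \<in> carrier_mat k c" "i < r" "j < c"
  shows "(X * Y) $$ (i, j) = (\<Sum>a<k. X $$ (i, a) * Y $$ (a, j))"
  using assms by (simp add: scalar_prod_def atLeast0LessThan)

lemma triple_product_entry:
  fixes L G :: "real mat"
  assumes L: "L \<in> carrier_mat k r" and G: "G \<in> carrier_mat r r" and ab: "a < k" "b < k"
  shows "(L * G * transpose_mat L) $$ (a, b)
    = (\<Sum>i<r. \<Sum>j<r. L $$ (a, i) * G $$ (i, j) * L $$ (b, j))"
proof -
  have "(L * G * transpose_mat L) $$ (a, b) = (\<Sum>j<r. (L * G) $$ (a, j) * transpose_mat L $$ (j, b))"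
    using ab L by (intro mult_mat_entry[OF mult_carrier_mat[OF L G]]) simp_all
  also have "\<dots> = (\<Sum>j<r. (\<Sum>i<r. L $$ (a, i) * G $$ (i, j)) * L $$ (b, j))"
    using L ab by (intro sum.cong refl arg_cong2[of _ _ _ _ "(*)"] mult_mat_entry[OF L G]) auto
  also have "\<dots> = (\<Sum>j<r. \<Sum>i<r. L $$ (a, i) * G $$ (i, j) * L $$ (b, j))"
    by (simp add: sum_distrib_right)
  also have "\<dots> = (\<Sum>i<r. \<Sum>j<r. L $$ (a, i) * G $$ (i, j) * L $$ (b, j))"
    by (rule sum.swap)
  finally show ?thesis .
qed

lemma gram_scalar_prod_eq_trace:
  assumes K: "K \<in> carrier_mat r k" and S: "S \<in> carrier_mat k k"
  shows "vectorize (transpose_mat K * K) \<bullet> vectorize S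
    = (\<Sum>i<r. (K * S * transpose_mat K) $$ (i, i))"
proof -
  have gram: "(transpose_mat K * K) $$ (a, b) = (\<Sum>i<r. K $$ (i, a) * K $$ (i, b))"
    if "a < k" "b < k" for a b
    using mult_mat_entry[of "transpose_mat K" k r K k a b] K that by simp
  have "vectorize (transpose_mat K * K) \<bullet> vectorize S
      = (\<Sum>a<k. \<Sum>b<k. (transpose_mat K * K) $$ (a, b) * S $$ (a, b))"
    using K S by (intro vectorize_scalar_prod) auto
  also have "\<dots> = (\<Sum>a<k. \<Sum>b<k. \<Sum>i<r. K $$ (i, a) * S $$ (a, b) * K $$ (i, b))"
    by (simp add: gram sum_distrib_left sum_distrib_right mult.commute mult.left_commute)
  also have "\<dots> = (\<Sum>a<k. \<Sum>i<r. \<Sum>b<k. K $$ (i, a) * S $$ (a, b) * K $$ (i, b))"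
    by (intro sum.cong refl sum.swap)
  also have "\<dots> = (\<Sum>i<r. \<Sum>a<k. \<Sum>b<k. K $$ (i, a) * S $$ (a, b) * K $$ (i, b))"
    by (rule sum.swap)
  also have "\<dots> = (\<Sum>i<r. (K * S * transpose_mat K) $$ (i, i))"
    using K S by (intro sum.cong refl triple_product_entry[symmetric]) auto
  finally show ?thesis .
qed

text \<open>
  With \<open>G = K S K\<^sup>T\<close>, the inner product of the Gram matrix \<open>K\<^sup>T K\<close> with \<open>S\<close> is the trace of \<open>G\<close>, which
  bounds all entries of \<open>G\<close> because \<open>G\<close> is positive semidefinite. A left inverse \<open>L\<close> of \<open>K\<close> recovers
  \<open>S = L G L\<^sup>T\<close>, so the entries of \<open>S\<close> are bounded by a fixed multiple of that trace.
\<close>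

lemma gram_coercive_on_psd_cone:
  assumes K: "K \<in> carrier_mat r k" and L: "L \<in> carrier_mat k r" and LK: "L * K = 1\<^sub>m k"
  obtains c where "c \<ge> 0"
    and "\<And>S. pos_semidef k S \<Longrightarrow> 0 \<le> vectorize (transpose_mat K * K) \<bullet> vectorize S"
    and "\<And>S. pos_semidef k S \<Longrightarrow>
      vnorm (vectorize S) \<le> c * (vectorize (transpose_mat K * K) \<bullet> vectorize S)"
proof
  define l where "l a b = (\<Sum>i<r. \<Sum>j<r. \<bar>L $$ (a, i)\<bar> * \<bar>L $$ (b, j)\<bar>)" for a b
  define c where "c = sqrt (\<Sum>a<k. \<Sum>b<k. (l a b)\<^sup>2)"
  show c: "c \<ge> 0"
    by (simp add: c_def sum_nonneg)
  fix S assume S: "pos_semidef k S"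
  then have carr: "S \<in> carrier_mat k k"
    by (simp add: pos_semidef_def)
  let ?G = "K * S * transpose_mat K"
  have G: "pos_semidef r ?G"
    by (rule pos_semidef_congruence[OF S K])
  then have Gcarr: "?G \<in> carrier_mat r r"
    by (simp add: pos_semidef_def)
  define T where "T = (\<Sum>i<r. ?G $$ (i, i))"
  have T: "vectorize (transpose_mat K * K) \<bullet> vectorize S = T"
    unfolding T_def by (rule gram_scalar_prod_eq_trace[OF K carr])
  have T0: "T \<ge> 0"
    unfolding T_def using pos_semidef_entries(1)[OF G] by (intro sum_nonneg) auto
  then show "0 \<le> vectorize (transpose_mat K * K) \<bullet> vectorize S"
    by (simp add: T)
  have Kt: "transpose_mat K \<in> carrier_mat k r" and Lt: "transpose_mat L \<in> carrier_mat r k"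
    using K L by simp_all
  have KS: "K * S \<in> carrier_mat r k"
    using K carr by simp
  have KtLt: "transpose_mat K * transpose_mat L = 1\<^sub>m k"
    by (simp only: transpose_mult[OF L K, symmetric] LK transpose_one)
  have "L * ?G * transpose_mat L = (L * (K * S)) * transpose_mat K * transpose_mat L"
    by (simp only: assoc_mult_mat[OF L KS Kt])
  also have "\<dots> = (L * (K * S)) * (transpose_mat K * transpose_mat L)"
    by (rule assoc_mult_mat[OF mult_carrier_mat[OF L KS] Kt Lt])
  also have "L * (K * S) = S"
    by (simp only: assoc_mult_mat[OF L K carr, symmetric] LK left_mult_one_mat[OF carr])
  also have "S * (transpose_mat K * transpose_mat L) = S"
    by (simp only: KtLt right_mult_one_mat[OF carr])
  finally have SL: "S = L * ?G * transpose_mat L" ..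
  have entry: "\<bar>S $$ (a, b)\<bar> \<le> l a b * T" if "a < k" "b < k" for a b
  proof -
    have "S $$ (a, b) = (\<Sum>i<r. \<Sum>j<r. L $$ (a, i) * ?G $$ (i, j) * L $$ (b, j))"
      by (subst SL) (rule triple_product_entry[OF L Gcarr that])
    also have "\<bar>\<dots>\<bar> \<le> (\<Sum>i<r. \<Sum>j<r. \<bar>L $$ (a, i) * ?G $$ (i, j) * L $$ (b, j)\<bar>)"
      by (intro order_trans[OF sum_abs] sum_mono sum_abs)
    also have "\<dots> \<le> (\<Sum>i<r. \<Sum>j<r. \<bar>L $$ (a, i)\<bar> * T * \<bar>L $$ (b, j)\<bar>)"
    proof (intro sum_mono)
      fix i j assume "i \<in> {..<r}" "j \<in> {..<r}"
      then have "\<bar>?G $$ (i, j)\<bar> \<le> T"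
        unfolding T_def by (intro pos_semidef_entry_le_trace[OF G]) simp_all
      then show "\<bar>L $$ (a, i) * ?G $$ (i, j) * L $$ (b, j)\<bar> \<le> \<bar>L $$ (a, i)\<bar> * T * \<bar>L $$ (b, j)\<bar>"
        unfolding abs_mult by (intro mult_right_mono mult_left_mono) auto
    qed
    also have "\<dots> = l a b * T"
      unfolding l_def sum_distrib_right by (intro sum.cong refl) (simp only: mult_ac)
    finally show ?thesis .
  qed
  have "(vnorm (vectorize S))\<^sup>2 = (\<Sum>a<k. \<Sum>b<k. (S $$ (a, b))\<^sup>2)"
    unfolding vnorm_sq vectorize_scalar_prod[OF carr carr] by (simp add: power2_eq_square)
  also have "\<dots> \<le> (\<Sum>a<k. \<Sum>b<k. (l a b)\<^sup>2 * T\<^sup>2)"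
  proof (intro sum_mono)
    fix a b assume "a \<in> {..<k}" "b \<in> {..<k}"
    then have "\<bar>S $$ (a, b)\<bar>\<^sup>2 \<le> (l a b * T)\<^sup>2"
      by (intro power_mono entry) simp_all
    then show "(S $$ (a, b))\<^sup>2 \<le> (l a b)\<^sup>2 * T\<^sup>2"
      by (simp add: power_mult_distrib)
  qed
  also have "\<dots> = (c * T)\<^sup>2"
    by (simp add: c_def power_mult_distrib sum_nonneg flip: sum_distrib_right)
  finally show "vnorm (vectorize S) \<le> c * (vectorize (transpose_mat K * K) \<bullet> vectorize S)"
    unfolding T by (rule power2_le_imp_le) (simp add: c T0)
qed

lemma pos_def_gram_left_inverse:
  assumes K: "K \<in> carrier_mat r k" and pd: "pos_def k (transpose_mat K * K)"
  obtains L where "L \<in> carrier_mat k r" "L * K = 1\<^sub>m k"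
proof -
  let ?R = "transpose_mat K * K"
  have Kt: "transpose_mat K \<in> carrier_mat k r"
    using K by simp
  have R: "?R \<in> carrier_mat k k"
    by (rule mult_carrier_mat[OF Kt K])
  have "det ?R \<noteq> 0"
  proof
    assume "det ?R = 0"
    then obtain v where v: "v \<in> carrier_vec k" "v \<noteq> 0\<^sub>v k" "?R *\<^sub>v v = 0\<^sub>v k"
      using det_0_iff_vec_prod_zero[OF R] by blast
    then have "v \<bullet> (?R *\<^sub>v v) = 0"
      by simp
    then show False
      using pd v unfolding pos_def_def by (metis less_irrefl)
  qed
  then have "?R \<in> Units (ring_mat TYPE(real) k ())"
    by (rule det_non_zero_imp_unit[OF R])
  then obtain B where B: "B \<in> carrier_mat k k" "B * ?R = 1\<^sub>m k"
    unfolding Units_def by (auto simp: ring_mat_simps ring_mat_def)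
  show thesis
  proof
    show "B * transpose_mat K \<in> carrier_mat k r"
      by (rule mult_carrier_mat[OF B(1) Kt])
    show "B * transpose_mat K * K = 1\<^sub>m k"
      by (simp only: assoc_mult_mat[OF B(1) Kt K] B(2))
  qed
qed

section \<open>Block structure of the coupling matrices\<close>

lemma append_cols_carrier:
  "X \<in> carrier_mat r c1 \<Longrightarrow> Y \<in> carrier_mat r c2 \<Longrightarrow> append_cols X Y \<in> carrier_mat r (c1 + c2)"
  unfolding append_cols_def by auto

lemma kron_carrier:
  "X \<in> carrier_mat r1 c1 \<Longrightarrow> Y \<in> carrier_mat r2 c2 \<Longrightarrow> kron X Y \<in> carrier_mat (r1 * r2) (c1 * c2)"
  unfolding kron_def by auto

lemma block_selector_carrier:
  assumes "offset ns a + ns a \<le> p"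
  shows "block_selector p ns a \<in> carrier_mat (ns a) p"
proof -
  have "block_selector p ns a
      \<in> carrier_mat (ns a) (offset ns a + (ns a + (p - offset ns a - ns a)))"
    unfolding block_selector_def by (intro append_cols_carrier) simp_all
  then show ?thesis
    using assms by simp
qed

lemma offset_add_le:
  assumes "1 \<le> a" "a \<le> t"
  shows "offset ns a + ns a \<le> (\<Sum>j = 1..t. ns j)"
proof -
  have "offset ns a + ns a = (\<Sum>j = 1..<Suc a. ns j)"
    using assms unfolding offset_def by simp
  also have "\<dots> \<le> (\<Sum>j = 1..t. ns j)"
    using assms by (intro sum_mono2) auto
  finally show ?thesis .
qed

lemma pair_list_index_range:
  assumes "j \<in> {1..t * (t - 1) div 2}"
  shows "1 \<le> xi t j" "xi t j \<le> t" "1 \<le> kappa t j" "kappa t j \<le> t"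
proof -
  have "pair_list t ! (j - 1) \<in> set (pair_list t)"
    using assms by (intro nth_mem) (auto simp: length_pair_list)
  then have "pair_list t ! (j - 1) \<in> {(a, b). 1 \<le> a \<and> a < b \<and> b \<le> t}"
    by (simp only: set_pair_list)
  then show "1 \<le> xi t j" "xi t j \<le> t" "1 \<le> kappa t j" "kappa t j \<le> t"
    by (auto simp: xi_def kappa_def split: prod.splits)
qed

lemma foldr_append_rows_carrier:
  assumes "\<And>X. X \<in> set Xs \<Longrightarrow> dim_col X = d" and "Y \<in> carrier_mat r d"
  shows "foldr (@\<^sub>r) Xs Y \<in> carrier_mat (sum_list (map dim_row Xs) + r) d"
  using assms(1)
proof (induction Xs)
  case Nil
  then show ?case
    using assms(2) by simp
next
  case (Cons X Xs)
  have "X \<in> carrier_mat (dim_row X) d"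
    using Cons.prems by auto
  moreover have "foldr (@\<^sub>r) Xs Y \<in> carrier_mat (sum_list (map dim_row Xs) + r) d"
    using Cons by simp
  ultimately have "X @\<^sub>r foldr (@\<^sub>r) Xs Y \<in> carrier_mat (dim_row X + (sum_list (map dim_row Xs) + r)) d"
    by (rule carrier_append_rows)
  then show ?case
    by (simp add: add.assoc)
qed

lemma vnorm_foldr_zero_rows:
  assumes Y: "Y \<in> carrier_mat r d" and v: "v \<in> carrier_vec d"
  shows "vnorm (foldr (@\<^sub>r) (map (\<lambda>j. 0\<^sub>m (h j) d) js) Y *\<^sub>v v) = vnorm (Y *\<^sub>v v)"
proof (induction js)
  case (Cons j js)
  let ?F = "foldr (@\<^sub>r) (map (\<lambda>j. 0\<^sub>m (h j) d) js) Y"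
  have F: "?F \<in> carrier_mat (sum_list (map dim_row (map (\<lambda>j. 0\<^sub>m (h j) d :: real mat) js)) + r) d"
    by (rule foldr_append_rows_carrier[OF _ Y]) auto
  have "(0\<^sub>m (h j) d @\<^sub>r ?F) *\<^sub>v v = (0\<^sub>m (h j) d *\<^sub>v v) @\<^sub>v (?F *\<^sub>v v)"
    by (rule mat_mult_append[OF zero_carrier_mat F v])
  also have "0\<^sub>m (h j) d *\<^sub>v v = 0\<^sub>v (h j)"
    using v by (intro eq_vecI) auto
  finally have eq: "(0\<^sub>m (h j) d @\<^sub>r ?F) *\<^sub>v v = 0\<^sub>v (h j) @\<^sub>v (?F *\<^sub>v v)" .
  have "(0\<^sub>v (h j) @\<^sub>v (?F *\<^sub>v v)) \<bullet> (0\<^sub>v (h j) @\<^sub>v (?F *\<^sub>v v)) = (?F *\<^sub>v v) \<bullet> (?F *\<^sub>v v)"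
    by (subst scalar_prod_append[OF zero_carrier_vec carrier_vec_dim_vec zero_carrier_vec
          carrier_vec_dim_vec]) simp
  then show ?case
    using Cons by (simp add: eq vnorm_def)
qed simp

section \<open>Boundedness of the proximal iteration\<close>

theorem theorem2:
  fixes m n l q M p s t N :: nat
    and ms ns :: "nat \<Rightarrow> nat"
    and A B2 B1 C D Q R V1 V2 calA calB :: "real mat"
    and Ai B2i F Vj1 Vj2 :: "nat \<Rightarrow> real mat"
    and f g :: "real vec \<Rightarrow> ereal"
    and H :: "real vec \<Rightarrow> real vec \<Rightarrow> real"
    and \<gamma> \<rho> \<mu> \<beta> \<tau> \<sigma> \<kappa>1 \<kappa>2 \<kappa>3 vsig :: real
    and W P z u :: "nat \<Rightarrow> real vec"
  assumes dims: "m \<ge> 1" "n \<ge> 1" "l \<ge> 1" "q \<ge> 1" "M \<ge> 1" "p = m + n"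
    and partitions:
      "m = (\<Sum>i = 1..s. ms i)" "\<forall>i \<in> {1..s}. ms i > 0"
      "n = (\<Sum>j = 1..t. ns j)" "\<forall>j \<in> {1..t}. ns j > 0"
    and carriers:
      "A \<in> carrier_mat n n" "B2 \<in> carrier_mat n m" "B1 \<in> carrier_mat n l"
      "C \<in> carrier_mat q n" "D \<in> carrier_mat q m"
      "\<forall>i \<in> {1..M}. Ai i \<in> carrier_mat n n" "\<forall>i \<in> {1..M}. B2i i \<in> carrier_mat n m"
    and Q_def: "Q = four_block_mat (B1 * transpose_mat B1) (0\<^sub>m n m) (0\<^sub>m m n) (0\<^sub>m m m)"
    and R_def: "R = four_block_mat (transpose_mat C * C) (0\<^sub>m n m) (0\<^sub>m m n) (transpose_mat D * D)"
    and F_def: "\<forall>i \<in> {1..M}. F i = four_block_mat (Ai i) (B2i i) (0\<^sub>m m n) (0\<^sub>m m m)"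
    and V1_def: "V1 = append_cols (0\<^sub>m m n) (1\<^sub>m m)"
    and V2_def: "V2 = append_cols (1\<^sub>m n) (0\<^sub>m n m)"
    and assumption1:
      "transpose_mat C * D = 0\<^sub>m n m" "pos_def m (transpose_mat D * D)"
      "pos_def n (transpose_mat C * C)" "pos_def n (B1 * transpose_mat B1)"
      "stabilizable A B2"
      "\<not> (\<exists>\<omega>. unobservable_mode A C (\<i> * complex_of_real \<omega>))"
    and assumption2:
      "\<exists>c. (\<forall>i \<in> {1..M}. c i \<ge> 0) \<and> (\<Sum>i = 1..M. c i) = 1 \<and>
         four_block_mat A B2 (0\<^sub>m m n) (0\<^sub>m m m) =
           mat p p (\<lambda>(a, b). \<Sum>i = 1..M. c i * F i $$ (a, b))"
    and assumption3:
      "\<exists>X. pos_def p X \<and> (\<forall>i \<in> {1..M}. pos_def n (Upsilon V2 Q (F i) X))"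
    and assumption4:
      "\<forall>X. pos_semidef p X \<and> (\<forall>i \<in> {1..M}. pos_semidef n (Upsilon V2 Q (F i) X))
         \<longrightarrow> pos_def n (upper_left n X)"
    and f_def: "f = (\<lambda>w. ereal (vectorize R \<bullet> w) + indicator_fun (psd_cone_vec p) w
      + (\<Sum>i = 1..M. indicator_fun (psd_cone_vec n)
           (vectorize (Upsilon V2 Q (F i) (unvectorize p p w)))))"
    and g_def: "g = (\<lambda>v. ereal (\<gamma> * real (block_l0 s t ms ns (unvectorize m n v))))"
    and gamma_pos: "\<gamma> > 0"
    and N_def: "N = t * (t - 1) div 2"
    and Vj1_def: "\<forall>j \<in> {1..N}. Vj1 j = block_selector p ns (xi t j)"
    and Vj2_def: "\<forall>j \<in> {1..N}. Vj2 j = transpose_mat (block_selector p ns (kappa t j))"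
    and calA_def: "calA = foldr (@\<^sub>r)
      (map (\<lambda>j. kron (transpose_mat (Vj2 j)) (Vj1 j)) [1..<Suc N]) (kron V2 V1)"
    and calB_def: "calB = foldr (@\<^sub>r)
      (map (\<lambda>j. 0\<^sub>m (dim_row (kron (transpose_mat (Vj2 j)) (Vj1 j))) (m * n)) [1..<Suc N])
      (- 1\<^sub>m (m * n))"
    and rho_pos: "\<rho> > 0"
    and H_def: "H = (\<lambda>w v. \<rho> / 2 * (vnorm (calA *\<^sub>v w + calB *\<^sub>v v))\<^sup>2)"
    and kappa_defs:
      "\<kappa>1 = \<rho> * spectral_norm (transpose_mat calA * calA)"
      "\<kappa>2 = \<rho> * spectral_norm (transpose_mat calB * calB)"
      "\<kappa>3 = \<rho> * spectral_norm (transpose_mat calA * calB)"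
    and sigma: "0 < \<sigma>" "\<sigma> < 1 / 24"
    and beta:
      "\<beta> > 4 * \<kappa>1 / (1 - 24 * \<sigma>) * (4 + 3 * \<sigma> + sqrt (24 - 168 * \<sigma> + 9 * \<sigma>\<^sup>2))"
      "4 * \<kappa>1 / (1 - 24 * \<sigma>) * (4 + 3 * \<sigma> + sqrt (24 - 168 * \<sigma> + 9 * \<sigma>\<^sup>2)) > 0"
    and mu: "\<mu> > \<kappa>2 + 16 * \<kappa>3\<^sup>2 / (\<sigma> * \<beta>)" "\<kappa>2 + 16 * \<kappa>3\<^sup>2 / (\<sigma> * \<beta>) > 0"
    and vsig:
      "vsig = 1 - 32 * \<kappa>1 / \<beta> - 128 * \<kappa>1\<^sup>2 / \<beta>\<^sup>2 - 24 * \<kappa>1 * \<sigma> / \<beta> - 24 * \<sigma>" "vsig > 0"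
    and tau:
      "max (\<beta> / 2) (\<beta> / (24 * \<sigma>) * (1 - 16 * \<kappa>1 / \<beta> - sqrt vsig)) < \<tau>"
      "\<tau> < \<beta> / (24 * \<sigma>) * (1 - 16 * \<kappa>1 / \<beta> + sqrt vsig)"
    and init:
      "W 0 \<in> carrier_vec (p * p)" "P 0 \<in> carrier_vec (m * n)"
      "z 0 \<in> carrier_vec (p * p)" "u 0 \<in> carrier_vec (p * p)"
    and step_P: "\<forall>k. P (Suc k) \<in> prox (m * n) (1 / \<mu>) g
      (P k - (1 / \<mu>) \<cdot>\<^sub>v gradient (m * n) (\<lambda>v. H (W k) v) (P k))"
    and step_z: "\<forall>k. z (Suc k) \<in> prox (p * p) (1 / \<beta>) f (W k + (1 / \<beta>) \<cdot>\<^sub>v u k)"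
    and step_W: "\<forall>k. W (Suc k) = W k - (1 / \<tau>) \<cdot>\<^sub>v
      (gradient (p * p) (\<lambda>w. H w (P (Suc k))) (W k) + u k + \<beta> \<cdot>\<^sub>v (W k - z (Suc k)))"
    and step_u: "\<forall>k. u (Suc k) = u k + (\<sigma> * \<beta>) \<cdot>\<^sub>v (W (Suc k) - z (Suc k))"
  shows "\<exists>K. \<forall>k. vnorm (W k) \<le> K \<and> vnorm (P k) \<le> K \<and> vnorm (z k) \<le> K \<and> vnorm (u k) \<le> K"
proof -
  define r where "r = dim_row calA"
  define At where "At = transpose_mat calA"
  define Bt where "Bt = transpose_mat calB"

  have block_carrier: "kron (transpose_mat (Vj2 j)) (Vj1 j) \<in> carrier_mat (ns (kappa t j) * ns (xi t j)) (p * p)"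
    if "j \<in> {1..N}" for j
  proof -
    have sel: "block_selector p ns a \<in> carrier_mat (ns a) p" if "1 \<le> a" "a \<le> t" for a
      using offset_add_le[OF that, of ns] partitions(3) dims(6) by (intro block_selector_carrier) simp
    have j: "j \<in> {1..t * (t - 1) div 2}"
      using that N_def by simp
    show ?thesis
      using sel pair_list_index_range[OF j] that Vj1_def Vj2_def by (intro kron_carrier) simp_all
  qed
  have V1: "V1 \<in> carrier_mat m p" and V2: "V2 \<in> carrier_mat n p"
    using append_cols_carrier[OF zero_carrier_mat[of m n] one_carrier_mat[of m]]
      append_cols_carrier[OF one_carrier_mat[of n] zero_carrier_mat[of n m]] dims(6)
    unfolding V1_def V2_def by (simp_all add: add.commute)
  have last: "kron V2 V1 \<in> carrier_mat (m * n) (p * p)"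
    using kron_carrier[OF V2 V1] by (simp add: mult.commute)
  let ?rows = "sum_list (map (\<lambda>j. dim_row (kron (transpose_mat (Vj2 j)) (Vj1 j))) [1..<Suc N])"
  have "calA \<in> carrier_mat (sum_list (map dim_row
      (map (\<lambda>j. kron (transpose_mat (Vj2 j)) (Vj1 j)) [1..<Suc N])) + m * n) (p * p)"
    unfolding calA_def
  proof (rule foldr_append_rows_carrier[OF _ last])
    fix X assume "X \<in> set (map (\<lambda>j. kron (transpose_mat (Vj2 j)) (Vj1 j)) [1..<Suc N])"
    then obtain j where "j \<in> {1..<Suc N}" "X = kron (transpose_mat (Vj2 j)) (Vj1 j)"
      unfolding set_map set_upt by blast
    then show "dim_col X = p * p"
      using block_carrier[of j] by simp
  qed
  then have calA0: "calA \<in> carrier_mat (?rows + m * n) (p * p)"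
    by (simp only: map_map comp_def)
  have neg_one: "- 1\<^sub>m (m * n) \<in> carrier_mat (m * n) (m * n)"
    by simp
  have "calB \<in> carrier_mat (sum_list (map dim_row
      (map (\<lambda>j. 0\<^sub>m (dim_row (kron (transpose_mat (Vj2 j)) (Vj1 j))) (m * n) :: real mat) [1..<Suc N])) + m * n) (m * n)"
    unfolding calB_def by (rule foldr_append_rows_carrier[OF _ neg_one]) auto
  then have calB0: "calB \<in> carrier_mat (?rows + m * n) (m * n)"
    by (simp only: map_map comp_def index_zero_mat)
  have r: "r = ?rows + m * n"
    using calA0 by (simp add: r_def)
  have calA: "calA \<in> carrier_mat r (p * p)" and calB: "calB \<in> carrier_mat r (m * n)"
    using calA0 calB0 by (simp_all only: r)
  have norm_calB: "vnorm (calB *\<^sub>v v) = vnorm v" if v: "v \<in> carrier_vec (m * n)" for v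
  proof -
    have "vnorm (calB *\<^sub>v v) = vnorm ((- 1\<^sub>m (m * n)) *\<^sub>v v)"
      unfolding calB_def by (rule vnorm_foldr_zero_rows[OF neg_one v])
    also have "(- 1\<^sub>m (m * n)) *\<^sub>v v = (-1) \<cdot>\<^sub>v v"
      using v by (intro eq_vecI) (auto simp: uminus_mult_mat_vec)
    finally show ?thesis
      by (simp add: vnorm_smult)
  qed

  have grad_W: "gradient (p * p) (\<lambda>w. H w v) w = \<rho> \<cdot>\<^sub>v (At *\<^sub>v (calA *\<^sub>v w + calB *\<^sub>v v))"
    if "w \<in> carrier_vec (p * p)" for w v
    unfolding H_def At_def
    using calB by (intro gradient_least_squares[OF calA _ that] carrier_vecI) simp
  have grad_P: "gradient (m * n) (\<lambda>v. H w v) v = \<rho> \<cdot>\<^sub>v (Bt *\<^sub>v (calA *\<^sub>v w + calB *\<^sub>v v))"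
    if v: "v \<in> carrier_vec (m * n)" for w v
  proof -
    have comm: "calA *\<^sub>v w + calB *\<^sub>v y = calB *\<^sub>v y + calA *\<^sub>v w" for y
      using calA calB by (intro comm_add_vec[of _ r] carrier_vecI) simp_all
    show ?thesis
      unfolding H_def Bt_def comm
      using calA by (intro gradient_least_squares[OF calB _ v] carrier_vecI) simp
  qed

  have zc: "z k \<in> carrier_vec (p * p)" for k
    using init(3) step_z by (cases k) (auto dest: proxD(1))
  have Pc: "P k \<in> carrier_vec (m * n)" for k
    using init(2) step_P by (cases k) (auto dest: proxD(1))
  have WUc: "W k \<in> carrier_vec (p * p) \<and> u k \<in> carrier_vec (p * p)" for k
  proof (induction k)
    case 0
    then show ?case
      using init by simp
  next
    case (Suc k)
    have "dim_vec (W (Suc k)) = p * p"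
      unfolding step_W[rule_format, of k] using zc[of "Suc k"] by simp
    moreover have "dim_vec (u (Suc k)) = p * p"
      unfolding step_u[rule_format, of k] using zc[of "Suc k"] by simp
    ultimately show ?case
      by (intro conjI carrier_vecI)
  qed
  then have Wc: "W k \<in> carrier_vec (p * p)" and uc: "u k \<in> carrier_vec (p * p)" for k
    by simp_all
  have dims_iter [simp]: "dim_vec (W k) = p * p" "dim_vec (u k) = p * p" "dim_vec (z k) = p * p"
    "dim_vec (P k) = m * n" for k
    using Wc uc zc Pc by (auto dest: carrier_vecD)

  \<comment> \<open>Where \<open>f\<close> is finite it is linear. The strictly feasible matrix of \<open>assumption3\<close> is such a
    point, so the minimizers \<open>z (Suc k)\<close> have a finite value as well.\<close>
  have f_zero_part: "f w = ereal (vectorize R \<bullet> w)"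
    if "w \<in> psd_cone_vec p"
      "\<And>i. i \<in> {1..M} \<Longrightarrow> vectorize (Upsilon V2 Q (F i) (unvectorize p p w)) \<in> psd_cone_vec n" for w
  proof -
    have "(\<Sum>i = 1..M. indicator_fun (psd_cone_vec n)
        (vectorize (Upsilon V2 Q (F i) (unvectorize p p w)))) = 0"
      using that by (intro sum.neutral) (simp add: indicator_fun_def)
    then show ?thesis
      using that(1) by (simp add: f_def indicator_fun_def)
  qed
  obtain X0 where X0: "pos_def p X0" "\<And>i. i \<in> {1..M} \<Longrightarrow> pos_def n (Upsilon V2 Q (F i) X0)"
    using assumption3 by blast
  have X0_carr: "X0 \<in> carrier_mat p p"
    using X0(1) by (simp add: pos_def_def)
  have f_X0: "f (vectorize X0) = ereal (vectorize R \<bullet> vectorize X0)"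
  proof (rule f_zero_part)
    show "vectorize X0 \<in> psd_cone_vec p"
      unfolding psd_cone_vec_def using pos_def_imp_pos_semidef[OF X0(1)] by blast
    show "vectorize (Upsilon V2 Q (F i) (unvectorize p p (vectorize X0))) \<in> psd_cone_vec n"
      if "i \<in> {1..M}" for i
      unfolding psd_cone_vec_def unvectorize_vectorize[OF X0_carr]
      using pos_def_imp_pos_semidef[OF X0(2)[OF that]] by blast
  qed
  have f_z: "z (Suc k) \<in> psd_cone_vec p \<and> f (z (Suc k)) = ereal (vectorize R \<bullet> z (Suc k))" for k
  proof -
    let ?I = "\<lambda>i. indicator_fun (psd_cone_vec n)
      (vectorize (Upsilon V2 Q (F i) (unvectorize p p (z (Suc k)))))"
    have "f (z (Suc k)) + ereal (\<beta> / 2 * (vnorm (z (Suc k) - (W k + (1 / \<beta>) \<cdot>\<^sub>v u k)))\<^sup>2)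
        \<le> ereal (vectorize R \<bullet> vectorize X0)
          + ereal (\<beta> / 2 * (vnorm (vectorize X0 - (W k + (1 / \<beta>) \<cdot>\<^sub>v u k)))\<^sup>2)"
      using proxD(2)[OF step_z[rule_format, of k] vectorize_carrier[OF X0_carr]] unfolding f_X0 .
    then have fin: "f (z (Suc k)) \<noteq> \<infinity>"
      by auto
    have cone: "z (Suc k) \<in> psd_cone_vec p"
    proof (rule ccontr)
      assume "z (Suc k) \<notin> psd_cone_vec p"
      then have "f (z (Suc k)) = \<infinity>"
        by (simp add: f_def indicator_fun_def)
      with fin show False ..
    qed
    have "?I i \<noteq> \<infinity>" if "i \<in> {1..M}" for i
    proof
      assume "?I i = \<infinity>"
      then have "(\<Sum>i = 1..M. ?I i) = \<infinity>"
        using that by (subst sum_Pinfty) blast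
      then have "f (z (Suc k)) = \<infinity>"
        by (simp add: f_def)
      with fin show False ..
    qed
    then have "f (z (Suc k)) = ereal (vectorize R \<bullet> z (Suc k))"
      by (intro f_zero_part cone) (metis indicator_fun_def)
    with cone show ?thesis ..
  qed

  \<comment> \<open>\<open>R\<close> is the Gram matrix of \<open>diag(C, D)\<close>, which has a left inverse since \<open>C\<^sup>T C\<close> and \<open>D\<^sup>T D\<close> are
    positive definite.\<close>
  obtain LC where LC: "LC \<in> carrier_mat n q" "LC * C = 1\<^sub>m n"
    using pos_def_gram_left_inverse[OF carriers(4) assumption1(3)] .
  obtain LD where LD: "LD \<in> carrier_mat m q" "LD * D = 1\<^sub>m m"
    using pos_def_gram_left_inverse[OF carriers(5) assumption1(2)] .
  define K where "K = four_block_mat C (0\<^sub>m q m) (0\<^sub>m q n) D"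
  define L where "L = four_block_mat LC (0\<^sub>m n q) (0\<^sub>m m q) LD"
  have K: "K \<in> carrier_mat (q + q) p" and L: "L \<in> carrier_mat p (q + q)"
    using carriers(4,5) LC(1) LD(1) dims(6) by (auto simp: K_def L_def)
  have "L * K = four_block_mat (LC * C + 0\<^sub>m n q * 0\<^sub>m q n) (LC * 0\<^sub>m q m + 0\<^sub>m n q * D)
      (0\<^sub>m m q * C + LD * 0\<^sub>m q n) (0\<^sub>m m q * 0\<^sub>m q m + LD * D)"
    unfolding K_def L_def
    by (rule mult_four_block_mat[OF LC(1) _ _ LD(1) carriers(4) _ _ carriers(5)]) simp_all
  also have "\<dots> = 1\<^sub>m p"
    using LC LD carriers(4,5) dims(6) by (simp add: add.commute)
  finally have LK: "L * K = 1\<^sub>m p" .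
  have Ct: "transpose_mat C \<in> carrier_mat n q" and Dt: "transpose_mat D \<in> carrier_mat m q"
    using carriers(4,5) by simp_all
  have "transpose_mat K = four_block_mat (transpose_mat C) (0\<^sub>m n q) (0\<^sub>m m q) (transpose_mat D)"
    unfolding K_def by (subst transpose_four_block_mat[OF carriers(4) _ _ carriers(5)]) simp_all
  then have "transpose_mat K * K
      = four_block_mat (transpose_mat C * C + 0\<^sub>m n q * 0\<^sub>m q n) (transpose_mat C * 0\<^sub>m q m + 0\<^sub>m n q * D)
      (0\<^sub>m m q * C + transpose_mat D * 0\<^sub>m q n) (0\<^sub>m m q * 0\<^sub>m q m + transpose_mat D * D)"
    unfolding K_def
    by (simp only: mult_four_block_mat[OF Ct zero_carrier_mat zero_carrier_mat Dt
          carriers(4) zero_carrier_mat zero_carrier_mat carriers(5)])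
  also have "\<dots> = R"
    unfolding R_def using carriers(4,5) by simp
  finally have gram: "transpose_mat K * K = R" .
  obtain cf where cf: "cf \<ge> 0" "\<And>S. pos_semidef p S \<Longrightarrow> 0 \<le> vectorize R \<bullet> vectorize S"
      "\<And>S. pos_semidef p S \<Longrightarrow> vnorm (vectorize S) \<le> cf * (vectorize R \<bullet> vectorize S)"
    using gram_coercive_on_psd_cone[OF K L LK] unfolding gram by blast
  have f_nonneg: "0 \<le> vectorize R \<bullet> z (Suc k)"
    and f_coercive: "vnorm (z (Suc k)) \<le> cf * (vectorize R \<bullet> z (Suc k))" for k
    using cf(2,3) f_z[of k] unfolding psd_cone_vec_def by auto

  have kappa1_nonneg: "\<kappa>1 \<ge> 0"
    using rho_pos spectral_norm_nonneg unfolding kappa_defs by simp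
  have beta_pos: "\<beta> > 0"
    using beta by linarith
  have mu_pos: "\<mu> > 0"
    using mu by linarith
  have op_A: "mat_op calA (embed (W k)) = embed (calA *\<^sub>v W k)" for k
    using Wc calA by (intro mat_op_embed) simp
  have op_B: "mat_op calB (embed (P k)) = embed (calB *\<^sub>v P k)" for k
    using Pc calB by (intro mat_op_embed) simp
  have op_sum: "mat_op calA (embed (W k)) + mat_op calB (embed (P j)) = embed (calA *\<^sub>v W k + calB *\<^sub>v P j)" for k j
    unfolding op_A op_B using calA calB by (intro embed_add[symmetric]) simp
  have sum_carr: "calA *\<^sub>v W k + calB *\<^sub>v P j \<in> carrier_vec r" for k j
    using calA calB by (intro carrier_vecI) simp
  have op_At: "\<rho> *\<^sub>R mat_op At (mat_op calA (embed (W k)) + mat_op calB (embed (P j)))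
      = embed (gradient (p * p) (\<lambda>w. H w (P j)) (W k))" for k j
    unfolding op_sum grad_W[OF Wc] embed_smult
    using sum_carr calA by (subst mat_op_embed) (auto simp: At_def)
  have op_Bt: "\<rho> *\<^sub>R mat_op Bt (mat_op calA (embed (W k)) + mat_op calB (embed (P j)))
      = embed (gradient (m * n) (\<lambda>v. H (W k) v) (P j))" for k j
    unfolding op_sum grad_P[OF Pc] embed_smult
    using sum_carr calB by (subst mat_op_embed) (auto simp: Bt_def)
  have dim_gW: "dim_vec (gradient (p * p) h w) = p * p" and dim_gP: "dim_vec (gradient (m * n) h v) = m * n" for h w v
    by (simp_all add: gradient_def)

  interpret linearized_admm "mat_op calA" "mat_op At" "mat_op calB" "mat_op Bt"
    "\<lambda>x. real_of_ereal (f (truncate (p * p) x))" "\<lambda>y. real_of_ereal (g (truncate (m * n) y))"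
    \<rho> \<mu> \<beta> \<tau> \<sigma> \<kappa>1 \<kappa>2 \<kappa>3 cf 1 "\<lambda>k. embed (W k)" "\<lambda>k. embed (z k)" "\<lambda>k. embed (u k)" "\<lambda>k. embed (P k)"
  proof (rule linearized_admm.intro, goal_cases)
    case 1 show ?case by (rule linear_mat_op)
  next
    case 2 show ?case by (rule linear_mat_op)
  next
    case 3 show ?case by (rule linear_mat_op)
  next
    case 4 show ?case unfolding At_def by (rule inner_mat_op)
  next
    case 5 show ?case unfolding Bt_def by (rule inner_mat_op)
  next
    case (6 x)
    have "mat_op At (mat_op calA x) = mat_op (At * calA) x"
      by (rule mat_op_mult) (simp add: At_def)
    then show ?case
      using norm_mat_op[of "At * calA" x] rho_pos by (simp add: kappa_defs At_def mult.assoc)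
  next
    case (7 y)
    have "mat_op Bt (mat_op calB y) = mat_op (Bt * calB) y"
      by (rule mat_op_mult) (simp add: Bt_def)
    then show ?case
      using norm_mat_op[of "Bt * calB" y] rho_pos by (simp add: kappa_defs Bt_def mult.assoc)
  next
    case (8 y)
    have "mat_op At (mat_op calB y) = mat_op (At * calB) y"
      using calA calB by (intro mat_op_mult) (simp add: At_def)
    then show ?case
      using norm_mat_op[of "At * calB" y] rho_pos by (simp add: kappa_defs At_def mult.assoc)
  next
    case (9 k)
    show ?case
      unfolding op_B norm_embed norm_calB[OF Pc] by simp
  next
    case 10 show ?case by (rule rho_pos)
  next
    case 11 show ?case by (rule beta_pos)
  next
    case 12 show ?case by (rule sigma(1))
  next
    case 13 show ?case using sigma(2) by simp
  next
    case 14 show ?case by (rule kappa1_nonneg)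
  next
    case 15 show ?case by (rule cf(1))
  next
    case 16 show ?case by simp
  next
    case 17 show ?case using tau(1) by simp
  next
    case 18
    show ?case
      using step_size_condition[OF sigma(1) beta_pos vsig] tau by simp
  next
    case 19 show ?case by (rule mu_pos)
  next
    case 20 show ?case by (rule mu(1))
  next
    case (21 k) show ?case
      using gamma_pos by (simp add: g_def)
  next
    case (22 k) show ?case
      unfolding truncate_embed[OF zc] norm_embed using f_coercive[of k] f_z[of k] by simp
  next
    case (23 k) show ?case
      unfolding truncate_embed[OF zc] using f_nonneg[of k] f_z[of k] by simp
  next
    case (24 k)
    let ?v = "P k - (1 / \<mu>) \<cdot>\<^sub>v gradient (m * n) (\<lambda>v. H (W k) v) (P k)"
    have eq: "embed (P j) - (embed (P k) - (1 / \<mu>) *\<^sub>R embed (gradient (m * n) (\<lambda>v. H (W k) v) (P k)))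
        = embed (P j - ?v)" for j
      by (simp add: embed_diff embed_smult dim_gP)
    show ?case
      unfolding op_Bt eq norm_embed truncate_embed[OF Pc]
      using proxD(2)[OF step_P[rule_format, of k] Pc[of k]] by (simp add: g_def)
  next
    case (25 k)
    let ?v = "W (Suc k) + (1 / \<beta>) \<cdot>\<^sub>v u (Suc k)"
    have eq: "embed (z j) - (embed (W (Suc k)) + (1 / \<beta>) *\<^sub>R embed (u (Suc k))) = embed (z j - ?v)" for j
      by (simp add: embed_diff embed_add embed_smult)
    show ?case
      unfolding eq norm_embed truncate_embed[OF zc]
      using proxD(2)[OF step_z[rule_format, of "Suc k"] zc[of "Suc k"]] f_z[of k] f_z[of "Suc k"] by simp
  next
    case (26 k)
    show ?case
      unfolding op_At by (subst step_W[rule_format, of k]) (simp add: embed_diff embed_add embed_smult dim_gW)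
  next
    case (27 k)
    show ?case
      by (subst step_u[rule_format, of k]) (simp add: embed_diff embed_add embed_smult)
  qed
  show ?thesis
    using bounded unfolding norm_embed .
qed

end
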